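(* Let $\mathbb{F}$ be a field, let $k,l\in\mathbb{N}$, let $x_1,\dots,x_n$ be variables, and let $a_1,\dots,a_n\in\mathbb{F}$ be distinct. For indices $i_1,\dots,i_{k+l+2}\in[n]$ define \[ E_{k,l}[i_1,\dots,i_{k+l+2}] \;=\; \det\begin{bmatrix} a_{i_j}^l x_{i_j} & a_{i_j}^{l-1}x_{i_j} & \cdots & x_{i_j} & a_{i_j}^{k} & a_{i_j}^{k-1} & \cdots & 1\end{bmatrix}_{j=1}^{k+l+2}, \] the determinant of the $(k+l+2)\times(k+l+2)$ matrix whose $j$-th row is the displayed row. Then the vanishing ideal $I(\mathrm{RFE}_{k,l})\subseteq\mathbb{F}[x_1,\dots,x_n]$ (for the abscissas $a_1,\dots,a_n$) is generated by the polynomials $E_{k,l}[i_1,\dots,i_{k+l+2}]$ over all choices $i_1,\dots,i_{k+l+2}\in[n]$. Moreover, for any fixed set $C\subseteq[n]$ with $|C|=k+1$, the polynomials $E_{k,l}[i_1,\dots,i_{k+l+2}]$ with $i_1<i_2<\cdots<i_{k+l+2}$ and $C\subseteq\{i_1,\dots,i_{k+l+2}\}$ form a generating set of $I(\mathrm{RFE}_{k,l})$ of minimum size.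
   Context: The Rational Function Evaluation generator $\mathrm{RFE}_{k,l}$ with distinct abscissas $a_1,\dots,a_n\in\mathbb{F}$, numerator degree $k$ and denominator degree $l$ takes as seed a rational function $f=g/h\in\mathbb{F}(\alpha)$ with $\deg g\le k$, $\deg h\le l$ and $h(a_i)\ne0$ for all $i$, and substitutes $x_i\gets f(a_i)$ for each $i\in[n]$. Its vanishing ideal $I(\mathrm{RFE}_{k,l})$ is the set of polynomials $p\in\mathbb{F}[x_1,\dots,x_n]$ such that $p(f(a_1),\dots,f(a_n))=0$ for all seeds; equivalently (with the field assumed sufficiently large, as the paper does), writing $g=\sum_{j\le k}c_j\alpha^j$, $h=\sum_{j\le l}d_j\alpha^j$ with indeterminate coefficients $c_j,d_j$, the rational function $p(g(a_1)/h(a_1),\dots,g(a_n)/h(a_n))$ in the $c_j,d_j$ is identically zero. *)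

theory Defs
  imports
    "HOL-Library.Poly_Mapping"
    "HOL-Computational_Algebra.Polynomial"
    "HOL-Computational_Algebra.Fraction_Field"
    "HOL-Algebra.Ideal"
    "Jordan_Normal_Form.Determinant"
begin

text \<open>
  Multivariate polynomials are finitely supported maps from monomials to coefficients, where a
  monomial is a finitely supported exponent map; addition and the convolution product are those of
  \<^theory>\<open>HOL-Library.Poly_Mapping\<close>.
\<close>

type_synonym 'a mpol = "(nat \<Rightarrow>\<^sub>0 nat) \<Rightarrow>\<^sub>0 'a"

definition mp_const :: "'a::comm_ring_1 \<Rightarrow> 'a mpol" where
  "mp_const c = Poly_Mapping.single 0 c"

definition mp_var :: "nat \<Rightarrow> 'a::comm_ring_1 mpol" where
  "mp_var i = Poly_Mapping.single (Poly_Mapping.single i 1) 1"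

definition mp_vars :: "'a::comm_ring_1 mpol \<Rightarrow> nat set" where
  "mp_vars p = (\<Union>m\<in>Poly_Mapping.keys p. Poly_Mapping.keys m)"

text \<open>
  \<open>mp_eval \<phi> x p\<close> is the value of \<open>p\<close> at the point \<open>x\<close>, with the coefficients embedded by \<open>\<phi>\<close>.
\<close>

definition mp_eval :: "('a::comm_ring_1 \<Rightarrow> 'b::comm_ring_1) \<Rightarrow> (nat \<Rightarrow> 'b) \<Rightarrow> 'a mpol \<Rightarrow> 'b" where
  "mp_eval \<phi> x p =
     (\<Sum>m\<in>Poly_Mapping.keys p.
        \<phi> (Poly_Mapping.lookup p m) * (\<Prod>i\<in>Poly_Mapping.keys m. x i ^ Poly_Mapping.lookup m i))"

text \<open>The ring \<open>F[x\<^sub>1, \<dots>, x\<^sub>n]\<close>.\<close>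

definition mp_ring :: "nat \<Rightarrow> 'a::comm_ring_1 mpol ring" where
  "mp_ring n = \<lparr>carrier = {p. mp_vars p \<subseteq> {1..n}}, monoid.mult = (*), one = 1, zero = 0, add = (+)\<rparr>"

text \<open>
  The vanishing ideal over all seeds \<open>g / h\<close>. The condition \<open>h \<noteq> 0\<close> is only needed if \<open>n = 0\<close>.
\<close>

definition rfe_seed_vanishing_ideal ::
    "nat \<Rightarrow> nat \<Rightarrow> nat \<Rightarrow> (nat \<Rightarrow> 'a::field) \<Rightarrow> 'a mpol set" where
  "rfe_seed_vanishing_ideal k l n a =
     {p \<in> carrier (mp_ring n).
        \<forall>g h :: 'a poly. Polynomial.degree g \<le> k \<and> Polynomial.degree h \<le> l \<and> h \<noteq> 0 \<and>
          (\<forall>i\<in>{1..n}. poly h (a i) \<noteq> 0) \<longrightarrow>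
          mp_eval (\<lambda>c. c) (\<lambda>i. poly g (a i) / poly h (a i)) p = 0}"

text \<open>
  The seed with indeterminate coefficients: the coefficients \<open>c\<^sub>0, \<dots>, c\<^sub>k\<close> of the numerator are the
  variables with index \<open>0, \<dots>, k\<close>, and the coefficients \<open>d\<^sub>0, \<dots>, d\<^sub>l\<close> of the denominator are those
  with index \<open>k + 1, \<dots>, k + l + 1\<close>. Both polynomials are evaluated at the scalar \<open>b\<close>.
\<close>

definition generic_num :: "nat \<Rightarrow> 'a::field \<Rightarrow> 'a mpol" where
  "generic_num k b = (\<Sum>j\<le>k. mp_var j * mp_const (b ^ j))"

definition generic_den :: "nat \<Rightarrow> nat \<Rightarrow> 'a::field \<Rightarrow> 'a mpol" where
  "generic_den k l b = (\<Sum>j\<le>l. mp_var (k + 1 + j) * mp_const (b ^ j))"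

text \<open>
  The vanishing ideal in its form for an arbitrary field: the substituted rational function in the
  indeterminate coefficients is identically zero, i.e. zero in the fraction field. Over an infinite
  field this is the set of polynomials vanishing at all seeds; over a finite field it is the
  vanishing ideal for seeds from any infinite extension field.
\<close>

definition rfe_vanishing_ideal ::
    "nat \<Rightarrow> nat \<Rightarrow> nat \<Rightarrow> (nat \<Rightarrow> 'a::field) \<Rightarrow> 'a mpol set" where
  "rfe_vanishing_ideal k l n a =
     {p \<in> carrier (mp_ring n).
        mp_eval (\<lambda>c. Fract (mp_const c) 1)
          (\<lambda>i. Fract (generic_num k (a i)) (generic_den k l (a i))) p = 0}"

text \<open>
  \<open>js\<close> is the list of the indices \<open>i\<^sub>1, \<dots>, i\<^sub>k\<^sub>+\<^sub>l\<^sub>+\<^sub>2\<close>. Rows and columns are counted from 0; the columns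
  \<open>0, \<dots>, l\<close> carry the variable.
\<close>

definition E_poly :: "(nat \<Rightarrow> 'a::field) \<Rightarrow> nat \<Rightarrow> nat \<Rightarrow> nat list \<Rightarrow> 'a mpol" where
  "E_poly a k l js =
     det (mat (k + l + 2) (k + l + 2) (\<lambda>(r, c).
       if c \<le> l then mp_const (a (js ! r) ^ (l - c)) * mp_var (js ! r)
       else mp_const (a (js ! r) ^ (k - (c - (l + 1))))))"

definition min_size_generating_set :: "('a, 'm) ring_scheme \<Rightarrow> 'a set \<Rightarrow> 'a set \<Rightarrow> bool" where
  "min_size_generating_set R I B \<longleftrightarrow>
     finite B \<and> B \<subseteq> carrier R \<and> genideal R B = I \<and>
     (\<forall>G. finite G \<and> G \<subseteq> carrier R \<and> genideal R G = I \<longrightarrow> card B \<le> card G)"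

end

theory Submission
  imports Defs "HOL-Library.Function_Algebras"
begin

text \<open>
  After evaluation at a point \<open>x\<close>, a kernel vector of the matrix defining \<open>E\<close> is a pair
  \<open>(g, h) \<noteq> 0\<close> of polynomials of degree at most \<open>k\<close> and \<open>l\<close> with \<open>h(a\<^sub>i) x\<^sub>i = g(a\<^sub>i)\<close> for the chosen
  indices. Hence every \<open>E\<close> vanishes at all seeds, and evaluation at 0/1 vectors shows that, for
  disjoint \<open>C\<close> and \<open>S\<close> of sizes \<open>k + 1\<close> and \<open>l + 1\<close>, the monomial \<open>x\<^sub>S\<close> occurs in \<open>E\<^sub>C\<^sub>\<union>\<^sub>S\<close> but in no
  other \<open>E\<close> whose index set contains \<open>C\<close>.

  All other monomials of \<open>E\<^sub>C\<^sub>\<union>\<^sub>S\<close> have smaller degree outside \<open>C\<close>, so modulo these polynomials every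
  polynomial reduces to one all of whose monomials have at most \<open>l\<close> variables outside \<open>C\<close>. Over an
  infinite field such a remainder, if nonzero, does not vanish at some seed: the variables outside
  \<open>C\<close> are sent to infinity one after the other by placing the zeros of \<open>h\<close> close to their abscissas,
  and the values on \<open>C\<close> are free because \<open>|C| = k + 1\<close>. Over a finite field \<open>F\<close> the same argument
  is run with seeds over \<open>F(t)\<close>.

  Minimality holds because the \<open>E\<close>'s are homogeneous of the same degree and linearly independent.
\<close>

section \<open>Evaluation and the polynomial ring\<close>

definition monom_val :: "(nat \<Rightarrow> 'b::comm_ring_1) \<Rightarrow> (nat \<Rightarrow>\<^sub>0 nat) \<Rightarrow> 'b" where
  "monom_val x m = (\<Prod>i\<in>Poly_Mapping.keys m. x i ^ Poly_Mapping.lookup m i)"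

lemma monom_val_superset:
  assumes "finite A" "Poly_Mapping.keys m \<subseteq> A"
  shows "monom_val x m = (\<Prod>i\<in>A. x i ^ Poly_Mapping.lookup m i)"
  unfolding monom_val_def
  by (rule prod.mono_neutral_left) (use assms in \<open>auto simp: in_keys_iff\<close>)

lemma monom_val_0 [simp]: "monom_val x 0 = 1"
  by (simp add: monom_val_def)

lemma monom_val_add: "monom_val x (m + m') = monom_val x m * monom_val x m'"
proof -
  let ?A = "Poly_Mapping.keys m \<union> Poly_Mapping.keys m'"
  have "Poly_Mapping.keys (m + m') \<subseteq> ?A"
    by (rule Poly_Mapping.keys_add)
  then show ?thesis
    by (simp add: monom_val_superset[of ?A] prod.distrib lookup_add power_add)
qed

lemma mp_eval_superset:
  assumes "comm_ring_hom \<phi>" "finite A" "Poly_Mapping.keys p \<subseteq> A"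
  shows "mp_eval \<phi> x p = (\<Sum>m\<in>A. \<phi> (Poly_Mapping.lookup p m) * monom_val x m)"
proof -
  interpret comm_ring_hom \<phi> by fact
  show ?thesis
    unfolding mp_eval_def monom_val_def
    by (rule sum.mono_neutral_left) (use assms in \<open>auto simp: in_keys_iff\<close>)
qed

lemma poly_mapping_sum_singles:
  "(\<Sum>m\<in>Poly_Mapping.keys p. Poly_Mapping.single m (Poly_Mapping.lookup p m)) = p"
    for p :: "'a \<Rightarrow>\<^sub>0 'b::comm_monoid_add"
  by (rule poly_mapping_eqI)
     (auto simp: lookup_sum lookup_single when_def sum.delta in_keys_iff)

lemma poly_mapping_mult_sum_singles:
  "p * q = (\<Sum>m\<in>Poly_Mapping.keys p. \<Sum>m'\<in>Poly_Mapping.keys q.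
      Poly_Mapping.single (m + m') (Poly_Mapping.lookup p m * Poly_Mapping.lookup q m'))"
    for p q :: "'a::comm_ring_1 mpol"
proof -
  have "p * q = (\<Sum>m\<in>Poly_Mapping.keys p. Poly_Mapping.single m (Poly_Mapping.lookup p m)) *
      (\<Sum>m'\<in>Poly_Mapping.keys q. Poly_Mapping.single m' (Poly_Mapping.lookup q m'))"
    by (simp add: poly_mapping_sum_singles)
  then show ?thesis
    by (simp add: sum_product mult_single)
qed

context
  fixes \<phi> :: "'a::comm_ring_1 \<Rightarrow> 'b::comm_ring_1" and x :: "nat \<Rightarrow> 'b"
  assumes hom: "comm_ring_hom \<phi>"
begin

interpretation comm_ring_hom \<phi> by (rule hom)

lemma mp_eval_single: "mp_eval \<phi> x (Poly_Mapping.single m c) = \<phi> c * monom_val x m"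
  by (subst mp_eval_superset[OF hom, of "{m}"]) auto

lemma mp_eval_zero: "mp_eval \<phi> x 0 = 0"
  by (simp add: mp_eval_def)

lemma mp_eval_add: "mp_eval \<phi> x (p + q) = mp_eval \<phi> x p + mp_eval \<phi> x q"
proof -
  let ?A = "Poly_Mapping.keys p \<union> Poly_Mapping.keys q"
  have "Poly_Mapping.keys (p + q) \<subseteq> ?A"
    by (rule Poly_Mapping.keys_add)
  then show ?thesis
    by (simp add: mp_eval_superset[OF hom, of ?A] sum.distrib lookup_add hom_add algebra_simps)
qed

lemma mp_eval_sum: "mp_eval \<phi> x (\<Sum>i\<in>A. f i) = (\<Sum>i\<in>A. mp_eval \<phi> x (f i))"
  by (induction A rule: infinite_finite_induct) (auto simp: mp_eval_zero mp_eval_add)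

lemma mp_eval_mult: "mp_eval \<phi> x (p * q) = mp_eval \<phi> x p * mp_eval \<phi> x q"
  by (subst poly_mapping_mult_sum_singles)
     (simp add: mp_eval_sum mp_eval_single monom_val_add hom_mult sum_product
       mp_eval_def[of _ _ p] mp_eval_def[of _ _ q] flip: monom_val_def, simp add: mult_ac)

lemma mp_eval_const: "mp_eval \<phi> x (mp_const c) = \<phi> c"
  by (simp add: mp_const_def mp_eval_single)

lemma mp_eval_var: "mp_eval \<phi> x (mp_var i) = x i"
  by (simp add: mp_var_def mp_eval_single monom_val_def)

lemma comm_ring_hom_mp_eval: "comm_ring_hom (mp_eval \<phi> x)"
proof
  show "mp_eval \<phi> x 1 = 1"
    using mp_eval_const[of 1] by (simp add: mp_const_def)
qed (simp_all add: mp_eval_zero mp_eval_add mp_eval_mult)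

end

section \<open>Coefficient embeddings used for evaluation\<close>

lemma comm_ring_hom_ident: "comm_ring_hom (\<lambda>c :: 'a::comm_ring_1. c)"
  by unfold_locales auto

lemma comm_ring_hom_mp_const: "comm_ring_hom (mp_const :: 'a::comm_ring_1 \<Rightarrow> 'a mpol)"
  by unfold_locales (auto simp: mp_const_def single_add mult_single)

lemma comm_ring_hom_pCons: "comm_ring_hom (\<lambda>c :: 'a::comm_ring_1. [:c:])"
  by unfold_locales (auto simp: one_pCons mult.commute)

lemma comm_ring_hom_Fract_one: "comm_ring_hom (\<lambda>c. Fract c 1)"
  by unfold_locales (auto simp: Zero_fract_def One_fract_def)

lemma comm_ring_hom_Fract_const:
  "comm_ring_hom (\<lambda>c :: 'a::field. Fract (mp_const c :: 'a mpol) 1)"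
proof -
  interpret comm_ring_hom "mp_const :: 'a \<Rightarrow> 'a mpol" by (rule comm_ring_hom_mp_const)
  show ?thesis
    by unfold_locales (auto simp: Zero_fract_def One_fract_def hom_add hom_mult)
qed

lemma comm_ring_hom_Fract_pCons:
  "comm_ring_hom (\<lambda>c :: 'a::field. Fract [:c:] 1)"
  by unfold_locales (auto simp: Zero_fract_def One_fract_def one_pCons mult.commute)

section \<open>The ring of polynomials in n variables and its ideals\<close>

lemma mp_vars_add: "mp_vars (p + q) \<subseteq> mp_vars p \<union> mp_vars q"
  using Poly_Mapping.keys_add[of p q] by (auto simp: mp_vars_def)

lemma mp_vars_uminus [simp]: "mp_vars (- p) = mp_vars p"
  by (simp add: mp_vars_def)

lemma mp_vars_mult: "mp_vars (p * q) \<subseteq> mp_vars p \<union> mp_vars q"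
proof
  fix i assume "i \<in> mp_vars (p * q)"
  then obtain m where m: "m \<in> Poly_Mapping.keys (p * q)" "i \<in> Poly_Mapping.keys m"
    by (auto simp: mp_vars_def)
  then obtain u v where "m = u + v" "u \<in> Poly_Mapping.keys p" "v \<in> Poly_Mapping.keys q"
    using Poly_Mapping.keys_mult[of p q] by auto
  with m(2) show "i \<in> mp_vars p \<union> mp_vars q"
    using Poly_Mapping.keys_add[of u v] by (auto simp: mp_vars_def)
qed

lemma mp_vars_const [simp]: "mp_vars (mp_const c) = {}"
  by (auto simp: mp_vars_def mp_const_def)

lemma mp_vars_zero [simp]: "mp_vars 0 = {}"
  by (auto simp: mp_vars_def)

lemma mp_vars_one [simp]: "mp_vars 1 = {}"
  using mp_vars_const[of 1] by (simp add: mp_const_def)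

lemma mem_carrier_mp_ring_iff: "p \<in> carrier (mp_ring n) \<longleftrightarrow> mp_vars p \<subseteq> {1..n}"
  by (simp add: mp_ring_def)

lemma mp_ring_simps [simp]:
  "x \<otimes>\<^bsub>mp_ring n\<^esub> y = x * y" "x \<oplus>\<^bsub>mp_ring n\<^esub> y = x + y"
  "\<one>\<^bsub>mp_ring n\<^esub> = 1" "\<zero>\<^bsub>mp_ring n\<^esub> = 0"
  by (auto simp: mp_ring_def)

lemma mp_ring_closed:
  "p \<in> carrier (mp_ring n) \<Longrightarrow> q \<in> carrier (mp_ring n) \<Longrightarrow> p + q \<in> carrier (mp_ring n)"
  "p \<in> carrier (mp_ring n) \<Longrightarrow> q \<in> carrier (mp_ring n) \<Longrightarrow> p * q \<in> carrier (mp_ring n)"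
  "p \<in> carrier (mp_ring n) \<Longrightarrow> - p \<in> carrier (mp_ring n)"
  "mp_const c \<in> carrier (mp_ring n)" "0 \<in> carrier (mp_ring n)"
  using mp_vars_add[of p q] mp_vars_mult[of p q] by (auto simp: mem_carrier_mp_ring_iff)

lemma cring_mp_ring: "cring (mp_ring n)"
proof (rule cringI)
  show "abelian_group (mp_ring n)"
  proof (rule abelian_groupI)
    fix p assume "p \<in> carrier (mp_ring n)"
    then have "- p \<in> carrier (mp_ring n)" "- p + p = 0"
      by (auto simp: mp_ring_closed)
    then have "\<exists>q\<in>carrier (mp_ring n). q + p = 0"
      by blast
    then show "\<exists>q\<in>carrier (mp_ring n). q \<oplus>\<^bsub>mp_ring n\<^esub> p = \<zero>\<^bsub>mp_ring n\<^esub>"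
      by simp
  qed (auto simp: mp_ring_closed ac_simps)
  show "Group.comm_monoid (mp_ring n)"
    by (rule comm_monoidI) (auto simp: mp_ring_closed ac_simps, auto simp: mem_carrier_mp_ring_iff)
qed (auto simp: algebra_simps)

text \<open>Closure under negation comes from multiplication by the constant -1.\<close>

lemma ideal_mp_ringI:
  assumes "I \<subseteq> carrier (mp_ring n)" "0 \<in> I"
    and add: "\<And>p q. p \<in> I \<Longrightarrow> q \<in> I \<Longrightarrow> p + q \<in> I"
    and mult: "\<And>p q. p \<in> carrier (mp_ring n) \<Longrightarrow> q \<in> I \<Longrightarrow> p * q \<in> I"
  shows "ideal I (mp_ring n :: 'a::comm_ring_1 mpol ring)"
proof -
  interpret cring "mp_ring n :: 'a mpol ring" by (rule cring_mp_ring)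
  show ?thesis
  proof (rule idealI)
    show "subgroup I (add_monoid (mp_ring n))"
    proof
      fix p assume p: "p \<in> I"
      then have "mp_const (-1) * p \<in> I"
        by (intro mult mp_ring_closed)
      moreover have "mp_const (-1) * p = - p"
        by (simp add: mp_const_def single_uminus)
      moreover have "inv\<^bsub>add_monoid (mp_ring n)\<^esub> p = - p"
        using p assms(1) minus_equality[of "- p" p] by (auto simp: a_inv_def mp_ring_closed)
      ultimately show "inv\<^bsub>add_monoid (mp_ring n)\<^esub> p \<in> I"
        by simp
    qed (use assms in \<open>auto simp: mp_ring_def\<close>)
    fix p q :: "'a mpol" assume "p \<in> I" "q \<in> carrier (mp_ring n)"
    then show "q \<otimes>\<^bsub>mp_ring n\<^esub> p \<in> I" "p \<otimes>\<^bsub>mp_ring n\<^esub> q \<in> I"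
      using mult[of q p] by (auto simp: mult.commute)
  qed (rule ring_axioms)
qed

lemma ideal_mp_ringD:
  assumes "ideal I (mp_ring n)"
  shows "I \<subseteq> carrier (mp_ring n)" "0 \<in> I"
    "p \<in> I \<Longrightarrow> q \<in> I \<Longrightarrow> p + q \<in> I" "p \<in> I \<Longrightarrow> q \<in> I \<Longrightarrow> p - q \<in> I"
    "p \<in> carrier (mp_ring n) \<Longrightarrow> q \<in> I \<Longrightarrow> p * q \<in> I"
proof -
  interpret ideal I "mp_ring n" by fact
  show sub: "I \<subseteq> carrier (mp_ring n)" "0 \<in> I"
    using a_subset additive_subgroup.zero_closed[OF is_additive_subgroup] by auto
  show add: "p \<in> I \<Longrightarrow> q \<in> I \<Longrightarrow> p + q \<in> I" for p q
    using additive_subgroup.a_closed[OF is_additive_subgroup, of p q] by simp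
  show mult: "p \<in> carrier (mp_ring n) \<Longrightarrow> q \<in> I \<Longrightarrow> p * q \<in> I" for p q
    using I_l_closed[of q p] by simp
  show "p \<in> I \<Longrightarrow> q \<in> I \<Longrightarrow> p - q \<in> I"
    using add[of p "mp_const (-1) * q"] mult[of "mp_const (-1)" q]
    by (simp add: mp_ring_closed) (simp add: mp_const_def single_uminus)
qed

section \<open>The polynomials \<open>E\<close> under evaluation\<close>

lemma poly_eq_sum_atMost:
  fixes p :: "'a::comm_semiring_1 poly"
  assumes "Polynomial.degree p \<le> n"
  shows "poly p x = (\<Sum>j\<le>n. coeff p j * x ^ j)"
  unfolding poly_altdef
  by (rule sum.mono_neutral_left) (use assms in \<open>auto simp: coeff_eq_0\<close>)

text \<open>The entries follow the column order of \<open>E_poly\<close>. The coefficients of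
  \<open>g\<close> are negated so that a matrix row times this vector gives the defect
  \<open>h(b) y - g(b)\<close> of the interpolation condition.\<close>

definition rfe_coeff_vec :: "nat \<Rightarrow> nat \<Rightarrow> 'b::comm_ring_1 poly \<Rightarrow> 'b poly \<Rightarrow> 'b vec" where
  "rfe_coeff_vec k l g h =
     vec (k + l + 2) (\<lambda>c. if c \<le> l then coeff h (l - c) else - coeff g (k - (c - (l + 1))))"

lemma rfe_row_product:
  fixes g h :: "'b::comm_ring_1 poly"
  assumes "Polynomial.degree g \<le> k" "Polynomial.degree h \<le> l"
  shows "vec (k + l + 2) (\<lambda>c. if c \<le> l then b ^ (l - c) * y else b ^ (k - (c - (l + 1))))
           \<bullet> rfe_coeff_vec k l g h = poly h b * y - poly g b"
proof -
  have split: "{0..<k + l + 2} = {..l} \<union> (\<lambda>c. l + 1 + c) ` {..k}"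
  proof -
    have "{0..<k + l + 2} = {..l} \<union> {l + 1..l + 1 + k}"
      by auto
    moreover have "(\<lambda>c. l + 1 + c) ` {..k} = {l + 1..l + 1 + k}"
      by (simp only: atMost_atLeast0 image_add_atLeastAtMost) simp
    ultimately show ?thesis by simp
  qed
  have "(\<Sum>c\<le>l. b ^ (l - c) * y * coeff h (l - c)) = (\<Sum>j\<le>l. b ^ j * y * coeff h j)"
    by (rule sum.reindex_bij_witness[of _ "\<lambda>j. l - j" "\<lambda>j. l - j"]) auto
  also have "\<dots> = poly h b * y"
    unfolding poly_eq_sum_atMost[OF assms(2)] sum_distrib_right by (simp add: mult_ac)
  finally have 1: "(\<Sum>c\<le>l. b ^ (l - c) * y * coeff h (l - c)) = poly h b * y" .
  have "(\<Sum>c\<le>k. b ^ (k - c) * coeff g (k - c)) = (\<Sum>j\<le>k. b ^ j * coeff g j)"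
    by (rule sum.reindex_bij_witness[of _ "\<lambda>j. k - j" "\<lambda>j. k - j"]) auto
  also have "\<dots> = poly g b"
    by (simp add: poly_eq_sum_atMost[OF assms(1)] mult_ac)
  finally have 2: "(\<Sum>c\<le>k. b ^ (k - c) * coeff g (k - c)) = poly g b" .
  have "vec (k + l + 2) (\<lambda>c. if c \<le> l then b ^ (l - c) * y else b ^ (k - (c - (l + 1))))
           \<bullet> rfe_coeff_vec k l g h =
      (\<Sum>c\<in>{0..<k + l + 2}. (if c \<le> l then b ^ (l - c) * y else b ^ (k - (c - (l + 1)))) *
        (if c \<le> l then coeff h (l - c) else - coeff g (k - (c - (l + 1)))))"
    by (simp add: scalar_prod_def rfe_coeff_vec_def)
  also have "\<dots> = (\<Sum>c\<le>l. b ^ (l - c) * y * coeff h (l - c)) -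
      (\<Sum>c\<le>k. b ^ (k - c) * coeff g (k - c))"
    unfolding split
    by (subst sum.union_disjoint) (auto simp: sum.reindex inj_on_def sum_negf intro!: sum.cong)
  finally show ?thesis
    by (simp only: 1 2)
qed

text \<open>Turns an arbitrary kernel vector of the matrix back into a pair of polynomials.\<close>

lemma rfe_coeff_vec_surj:
  fixes v :: "'b::comm_ring_1 vec"
  assumes "v \<in> carrier_vec (k + l + 2)"
  obtains g h where "Polynomial.degree g \<le> k" "Polynomial.degree h \<le> l"
    "v = rfe_coeff_vec k l g h"
proof
  define g where "g = (\<Sum>j\<le>k. Polynomial.monom (- (v $ (l + 1 + (k - j)))) j)"
  define h where "h = (\<Sum>j\<le>l. Polynomial.monom (v $ (l - j)) j)"
  have cg: "coeff g j = (if j \<le> k then - (v $ (l + 1 + (k - j))) else 0)" for j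
    by (simp add: g_def coeff_sum)
  have ch: "coeff h j = (if j \<le> l then v $ (l - j) else 0)" for j
    by (simp add: h_def coeff_sum)
  show "Polynomial.degree g \<le> k" "Polynomial.degree h \<le> l"
    by (auto intro!: degree_le simp: cg ch)
  show "v = rfe_coeff_vec k l g h"
  proof (rule eq_vecI)
    show "dim_vec v = dim_vec (rfe_coeff_vec k l g h)"
      using assms by (simp add: rfe_coeff_vec_def)
    fix c assume "c < dim_vec (rfe_coeff_vec k l g h)"
    then show "v $ c = rfe_coeff_vec k l g h $ c"
      by (auto simp: rfe_coeff_vec_def cg ch)
  qed
qed

lemma rfe_coeff_vec_eq_0_iff:
  fixes g h :: "'b::comm_ring_1 poly"
  assumes "Polynomial.degree g \<le> k" "Polynomial.degree h \<le> l"
  shows "rfe_coeff_vec k l g h = 0\<^sub>v (k + l + 2) \<longleftrightarrow> g = 0 \<and> h = 0"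
proof
  assume *: "rfe_coeff_vec k l g h = 0\<^sub>v (k + l + 2)"
  have "coeff h j = 0" for j
  proof (cases "j \<le> l")
    case True
    then show ?thesis
      using arg_cong[OF *, of "\<lambda>v. v $ (l - j)"] by (simp add: rfe_coeff_vec_def)
  next
    case False
    then show ?thesis using assms by (simp add: coeff_eq_0)
  qed
  moreover have "coeff g j = 0" for j
  proof (cases "j \<le> k")
    case True
    then show ?thesis
      using arg_cong[OF *, of "\<lambda>v. v $ (l + 1 + (k - j))"]
      by (auto simp: rfe_coeff_vec_def split: if_splits)
  next
    case False
    then show ?thesis using assms by (simp add: coeff_eq_0)
  qed
  ultimately show "g = 0 \<and> h = 0"
    by (simp add: poly_eq_iff)
qed (auto simp: rfe_coeff_vec_def)

text \<open>A square matrix over a field is singular iff it has a nonzero kernel vector, and kernel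
  vectors are coefficient vectors of pairs \<open>(g, h)\<close>. The target field is left free
  because the criterion is applied both over the fraction field, at the generic seed, and over the
  coefficient field, at 0/1 vectors.\<close>

lemma mp_eval_E_poly_eq_0_iff:
  fixes \<phi> :: "'a::field \<Rightarrow> 'b::field"
  assumes hom: "comm_ring_hom \<phi>" and len: "length js = k + l + 2"
  shows "mp_eval \<phi> x (E_poly a k l js) = 0 \<longleftrightarrow>
    (\<exists>g h. Polynomial.degree g \<le> k \<and> Polynomial.degree h \<le> l \<and> (g \<noteq> 0 \<or> h \<noteq> 0) \<and>
       (\<forall>i\<in>set js. poly h (\<phi> (a i)) * x i = poly g (\<phi> (a i))))"
proof -
  interpret phi: comm_ring_hom \<phi> by fact
  interpret ev: comm_ring_hom "mp_eval \<phi> x" by (rule comm_ring_hom_mp_eval[OF hom])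
  let ?N = "k + l + 2"
  define M where "M = mat ?N ?N (\<lambda>(r, c). if c \<le> l then \<phi> (a (js ! r)) ^ (l - c) * x (js ! r)
       else \<phi> (a (js ! r)) ^ (k - (c - (l + 1))))"
  have M: "M \<in> carrier_mat ?N ?N"
    by (simp add: M_def)
  have ev_det: "mp_eval \<phi> x (E_poly a k l js) = det M"
    unfolding E_poly_def ev.hom_det[symmetric] M_def
    by (intro arg_cong[of _ _ det] eq_matI)
       (auto simp: ev.hom_mult mp_eval_const[OF hom] mp_eval_var[OF hom] phi.hom_power)
  have row: "row M r = vec ?N (\<lambda>c. if c \<le> l then \<phi> (a (js ! r)) ^ (l - c) * x (js ! r)
       else \<phi> (a (js ! r)) ^ (k - (c - (l + 1))))" if "r < ?N" for r
    using that by (intro eq_vecI) (auto simp: M_def)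
  have ker: "M *\<^sub>v rfe_coeff_vec k l g h = 0\<^sub>v ?N \<longleftrightarrow>
      (\<forall>i\<in>set js. poly h (\<phi> (a i)) * x i = poly g (\<phi> (a i)))"
    if "Polynomial.degree g \<le> k" "Polynomial.degree h \<le> l" for g h
  proof -
    have "M *\<^sub>v rfe_coeff_vec k l g h = 0\<^sub>v ?N \<longleftrightarrow>
        (\<forall>r<?N. row M r \<bullet> rfe_coeff_vec k l g h = 0)"
      using M by (auto simp: vec_eq_iff)
    also have "\<dots> \<longleftrightarrow>
        (\<forall>r<?N. poly h (\<phi> (a (js ! r))) * x (js ! r) = poly g (\<phi> (a (js ! r))))"
      using rfe_row_product[OF that] by (auto simp: row)
    also have "\<dots> \<longleftrightarrow> (\<forall>i\<in>set js. poly h (\<phi> (a i)) * x i = poly g (\<phi> (a i)))"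
      using len by (auto simp: all_set_conv_all_nth)
    finally show ?thesis .
  qed
  have "det M = 0 \<longleftrightarrow> (\<exists>v. v \<in> carrier_vec ?N \<and> v \<noteq> 0\<^sub>v ?N \<and> M *\<^sub>v v = 0\<^sub>v ?N)"
    by (rule det_0_iff_vec_prod_zero[OF M])
  also have "\<dots> \<longleftrightarrow> (\<exists>g h. Polynomial.degree g \<le> k \<and> Polynomial.degree h \<le> l \<and>
      rfe_coeff_vec k l g h \<noteq> 0\<^sub>v ?N \<and> M *\<^sub>v rfe_coeff_vec k l g h = 0\<^sub>v ?N)"
  proof
    assume "\<exists>v. v \<in> carrier_vec ?N \<and> v \<noteq> 0\<^sub>v ?N \<and> M *\<^sub>v v = 0\<^sub>v ?N"
    then obtain v where v: "v \<in> carrier_vec ?N" "v \<noteq> 0\<^sub>v ?N" "M *\<^sub>v v = 0\<^sub>v ?N"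
      by blast
    obtain g h where "Polynomial.degree g \<le> k" "Polynomial.degree h \<le> l" "v = rfe_coeff_vec k l g h"
      using rfe_coeff_vec_surj[OF v(1)] by blast
    with v show "\<exists>g h. Polynomial.degree g \<le> k \<and> Polynomial.degree h \<le> l \<and>
      rfe_coeff_vec k l g h \<noteq> 0\<^sub>v ?N \<and> M *\<^sub>v rfe_coeff_vec k l g h = 0\<^sub>v ?N"
      by blast
  next
    assume "\<exists>g h. Polynomial.degree g \<le> k \<and> Polynomial.degree h \<le> l \<and>
      rfe_coeff_vec k l g h \<noteq> 0\<^sub>v ?N \<and> M *\<^sub>v rfe_coeff_vec k l g h = 0\<^sub>v ?N"
    moreover have "rfe_coeff_vec k l g h \<in> carrier_vec ?N" for g h :: "'b poly"
      by (simp add: rfe_coeff_vec_def)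
    ultimately show "\<exists>v. v \<in> carrier_vec ?N \<and> v \<noteq> 0\<^sub>v ?N \<and> M *\<^sub>v v = 0\<^sub>v ?N"
      by blast
  qed
  also have "\<dots> \<longleftrightarrow> (\<exists>g h. Polynomial.degree g \<le> k \<and> Polynomial.degree h \<le> l \<and>
      (g \<noteq> 0 \<or> h \<noteq> 0) \<and> (\<forall>i\<in>set js. poly h (\<phi> (a i)) * x i = poly g (\<phi> (a i))))"
    by (intro ex_cong1 conj_cong refl)
       (simp_all only: ker rfe_coeff_vec_eq_0_iff de_Morgan_conj simp_thms)
  finally show ?thesis
    by (simp only: ev_det)
qed

section \<open>Squarefree monomials and the expansion of the determinant\<close>

definition squarefree_monom :: "nat set \<Rightarrow> nat \<Rightarrow>\<^sub>0 nat" where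
  "squarefree_monom T = (\<Sum>i\<in>T. Poly_Mapping.single i 1)"

lemma lookup_squarefree_monom:
  "finite T \<Longrightarrow> Poly_Mapping.lookup (squarefree_monom T) i = (if i \<in> T then 1 else 0)"
  by (simp add: squarefree_monom_def lookup_sum lookup_single when_def sum.delta)

lemma keys_squarefree_monom: "finite T \<Longrightarrow> Poly_Mapping.keys (squarefree_monom T) = T"
  by (auto simp: in_keys_iff lookup_squarefree_monom split: if_splits)

lemma monom_val_squarefree_monom:
  "finite T \<Longrightarrow> monom_val x (squarefree_monom T) = (\<Prod>i\<in>T. x i)"
  by (simp add: monom_val_def keys_squarefree_monom lookup_squarefree_monom)

lemma prod_mp_var:
  "finite T \<Longrightarrow> (\<Prod>i\<in>T. mp_var i) = Poly_Mapping.single (squarefree_monom T) 1"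
  by (induction T rule: finite_induct) (simp_all add: squarefree_monom_def mp_var_def mult_single)

text \<open>In the Leibniz formula a permutation picks up the variable of row \<open>r\<close>
  exactly if it sends \<open>r\<close> to one of the first \<open>l + 1\<close> columns. This
  happens in \<open>l + 1\<close> rows, which belong to distinct variables since \<open>js\<close>
  is distinct.\<close>

lemma E_poly_expansion:
  fixes a :: "nat \<Rightarrow> 'a::field"
  assumes dist: "distinct js" and len: "length js = k + l + 2"
  obtains c where "E_poly a k l js =
    (\<Sum>T | T \<subseteq> set js \<and> card T = l + 1. Poly_Mapping.single (squarefree_monom T) (c T))"
proof -
  interpret const: comm_ring_hom "mp_const :: 'a \<Rightarrow> 'a mpol" by (rule comm_ring_hom_mp_const)
  let ?N = "k + l + 2"
  let ?P = "{\<pi>. \<pi> permutes {0..<?N}}"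
  \<comment> \<open>The indices whose variables occur in the Leibniz term of a permutation;
    \<open>e\<close> is the signed scalar part of that term.\<close>
  define T where "T \<pi> = (!) js ` {r \<in> {0..<?N}. \<pi> r \<le> l}" for \<pi>
  define e where "e \<pi> = signof \<pi> * (\<Prod>r = 0..<?N. if \<pi> r \<le> l then a (js ! r) ^ (l - \<pi> r)
      else a (js ! r) ^ (k - (\<pi> r - (l + 1))))" for \<pi>
  have inj: "inj_on ((!) js) {0..<?N}"
    using dist len by (auto simp: inj_on_def nth_eq_iff_index_eq)
  have "E_poly a k l js = (\<Sum>\<pi>\<in>?P. signof \<pi> *
      (\<Prod>r = 0..<?N. if \<pi> r \<le> l then mp_const (a (js ! r) ^ (l - \<pi> r)) * mp_var (js ! r)
       else mp_const (a (js ! r) ^ (k - (\<pi> r - (l + 1))))))"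
    unfolding E_poly_def
    by (subst det_def'[of _ ?N])
       (auto intro!: sum.cong prod.cong arg_cong2[of _ _ _ _ "(*)"] dest: permutes_in_image)
  also have "\<dots> = (\<Sum>\<pi>\<in>?P. Poly_Mapping.single (squarefree_monom (T \<pi>)) (e \<pi>))"
  proof (rule sum.cong[OF refl])
    fix \<pi> assume "\<pi> \<in> ?P"
    have "(\<Prod>r = 0..<?N. if \<pi> r \<le> l then mp_const (a (js ! r) ^ (l - \<pi> r)) * mp_var (js ! r)
        else mp_const (a (js ! r) ^ (k - (\<pi> r - (l + 1))))) =
      (\<Prod>r = 0..<?N. mp_const (if \<pi> r \<le> l then a (js ! r) ^ (l - \<pi> r)
        else a (js ! r) ^ (k - (\<pi> r - (l + 1)))) * (if \<pi> r \<le> l then mp_var (js ! r) else 1))"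
      by (rule prod.cong) auto
    also have "\<dots> = mp_const (\<Prod>r = 0..<?N. if \<pi> r \<le> l then a (js ! r) ^ (l - \<pi> r)
        else a (js ! r) ^ (k - (\<pi> r - (l + 1)))) * (\<Prod>r | r \<in> {0..<?N} \<and> \<pi> r \<le> l. mp_var (js ! r))"
      by (subst prod.distrib) (simp only: const.hom_prod prod.inter_filter[OF finite_atLeastLessThan])
    also have "(\<Prod>r | r \<in> {0..<?N} \<and> \<pi> r \<le> l. mp_var (js ! r) :: 'a mpol) = (\<Prod>i\<in>T \<pi>. mp_var i)"
      unfolding T_def by (subst prod.reindex) (use inj in \<open>auto simp: inj_on_def\<close>)
    also have "\<dots> = Poly_Mapping.single (squarefree_monom (T \<pi>)) 1"
      by (rule prod_mp_var) (simp add: T_def)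
    finally show "signof \<pi> * (\<Prod>r = 0..<?N.
          if \<pi> r \<le> l then mp_const (a (js ! r) ^ (l - \<pi> r)) * mp_var (js ! r)
          else mp_const (a (js ! r) ^ (k - (\<pi> r - (l + 1))))) =
        Poly_Mapping.single (squarefree_monom (T \<pi>)) (e \<pi>)"
      by (simp add: e_def mp_const_def mult_single sign_def single_uminus)
  qed
  \<comment> \<open>Permutations that yield the same monomial are collected.\<close>
  also have "\<dots> = (\<Sum>U | U \<subseteq> set js \<and> card U = l + 1. \<Sum>\<pi> | \<pi> \<in> ?P \<and> T \<pi> = U.
      Poly_Mapping.single (squarefree_monom (T \<pi>)) (e \<pi>))"
  proof (rule sum.group[symmetric])
    show "finite ?P" by (rule finite_permutations) simp
    show "finite {U. U \<subseteq> set js \<and> card U = l + 1}" by simp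
    show "T ` ?P \<subseteq> {U. U \<subseteq> set js \<and> card U = l + 1}"
    proof safe
      fix \<pi> assume pi: "\<pi> permutes {0..<?N}"
      show "i \<in> set js" if "i \<in> T \<pi>" for i
        using that len by (auto simp: T_def)
      have "card (T \<pi>) = card {r \<in> {0..<?N}. \<pi> r \<le> l}"
        unfolding T_def by (rule card_image) (use inj in \<open>auto simp: inj_on_def\<close>)
      also have "\<dots> = card {..l}"
      proof (rule bij_betw_same_card[of \<pi>], rule bij_betwI')
        show "(\<pi> r = \<pi> s) = (r = s)" for r s
          using pi by (simp add: permutes_inj inj_eq)
        show "\<exists>r\<in>{r \<in> {0..<?N}. \<pi> r \<le> l}. c = \<pi> r" if "c \<in> {..l}" for c
        proof -
          have "c \<in> \<pi> ` {0..<?N}" unfolding permutes_image[OF pi] using that by simp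
          with that show ?thesis by auto
        qed
      qed auto
      finally show "card (T \<pi>) = l + 1" by simp
    qed
  qed
  also have "\<dots> = (\<Sum>U | U \<subseteq> set js \<and> card U = l + 1.
      Poly_Mapping.single (squarefree_monom U) (\<Sum>\<pi> | \<pi> \<in> ?P \<and> T \<pi> = U. e \<pi>))"
  proof (rule sum.cong[OF refl])
    have single_sum: "(\<Sum>i\<in>A. Poly_Mapping.single m (f i)) = Poly_Mapping.single m (\<Sum>i\<in>A. f i)"
      for A and m :: "nat \<Rightarrow>\<^sub>0 nat" and f :: "(nat \<Rightarrow> nat) \<Rightarrow> 'a"
      by (induction A rule: infinite_finite_induct) (auto simp: single_add)
    fix U
    show "(\<Sum>\<pi> | \<pi> \<in> ?P \<and> T \<pi> = U. Poly_Mapping.single (squarefree_monom (T \<pi>)) (e \<pi>)) =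
      Poly_Mapping.single (squarefree_monom U) (\<Sum>\<pi> | \<pi> \<in> ?P \<and> T \<pi> = U. e \<pi>)"
      unfolding single_sum[symmetric] by (rule sum.cong) auto
  qed
  finally show ?thesis by (rule that)
qed

section \<open>Specialization of the generic seed\<close>

text \<open>In general \<open>\<psi>\<close> does not extend to the whole fraction field, since it
  may kill denominators. It does extend to the fractions that have a denominator outside its kernel,
  and the evaluation stays among these.\<close>

lemma mp_eval_Fract_specialize:
  fixes \<psi> :: "'r::idom \<Rightarrow> 'b::field" and \<iota> :: "'a::comm_ring_1 \<Rightarrow> 'r"
  assumes "comm_ring_hom \<psi>" and nz: "\<And>i. i \<in> mp_vars p \<Longrightarrow> \<psi> (den i) \<noteq> 0"
    and zero: "mp_eval (\<lambda>c. Fract (\<iota> c) 1) (\<lambda>i. Fract (num i) (den i)) p = 0"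
  shows "mp_eval (\<lambda>c. \<psi> (\<iota> c)) (\<lambda>i. \<psi> (num i) / \<psi> (den i)) p = 0"
proof -
  interpret comm_ring_hom \<psi> by fact
  \<comment> \<open>The extension of \<open>\<psi>\<close> as a relation, which spares a proof that
    it is single-valued: compatibility with sums and products suffices, plus the fact that 0 is
    related to 0 only.\<close>
  define rel where "rel y z \<longleftrightarrow> (\<exists>r s. y = Fract r s \<and> \<psi> s \<noteq> 0 \<and> z = \<psi> r / \<psi> s)" for y z
  have rel_Fract: "rel (Fract r s) (\<psi> r / \<psi> s)" if "\<psi> s \<noteq> 0" for r s
    using that by (auto simp: rel_def)
  have rel_of: "rel (Fract r 1) (\<psi> r)" for r
    using rel_Fract[of 1 r] by simp
  have rel_add: "rel (y + y') (z + z')" if rels: "rel y z" "rel y' z'" for y y' z z'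
  proof -
    obtain r s r' s' where *: "y = Fract r s" "\<psi> s \<noteq> 0" "z = \<psi> r / \<psi> s"
      "y' = Fract r' s'" "\<psi> s' \<noteq> 0" "z' = \<psi> r' / \<psi> s'"
      using rels unfolding rel_def by blast
    then have "s \<noteq> 0" "s' \<noteq> 0" by auto
    with * have "y + y' = Fract (r * s' + r' * s) (s * s')"
      "z + z' = \<psi> (r * s' + r' * s) / \<psi> (s * s')" "\<psi> (s * s') \<noteq> 0"
      by (auto simp: hom_add hom_mult field_simps)
    then show ?thesis unfolding rel_def by blast
  qed
  have rel_mult: "rel (y * y') (z * z')" if rels: "rel y z" "rel y' z'" for y y' z z'
  proof -
    obtain r s r' s' where *: "y = Fract r s" "\<psi> s \<noteq> 0" "z = \<psi> r / \<psi> s"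
      "y' = Fract r' s'" "\<psi> s' \<noteq> 0" "z' = \<psi> r' / \<psi> s'"
      using rels unfolding rel_def by blast
    then have "y * y' = Fract (r * r') (s * s')"
      "z * z' = \<psi> (r * r') / \<psi> (s * s')" "\<psi> (s * s') \<noteq> 0"
      by (auto simp: hom_mult)
    then show ?thesis unfolding rel_def by blast
  qed
  have rel_0: "rel 0 0" and rel_1: "rel 1 1"
    using rel_of[of 0] rel_of[of 1] by (simp_all add: Zero_fract_def One_fract_def)
  have rel_power: "rel (y ^ e) (z ^ e)" if "rel y z" for y z e
    by (induction e) (auto intro: rel_1 rel_mult that)
  have rel_prod: "rel (\<Prod>i\<in>A. f i) (\<Prod>i\<in>A. g i)" if "\<And>i. i \<in> A \<Longrightarrow> rel (f i) (g i)"
    for f g and A :: "nat set"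
    using that by (induction A rule: infinite_finite_induct) (auto intro: rel_1 rel_mult)
  have rel_sum: "rel (\<Sum>i\<in>A. f i) (\<Sum>i\<in>A. g i)" if "\<And>i. i \<in> A \<Longrightarrow> rel (f i) (g i)"
    for f g and A :: "(nat \<Rightarrow>\<^sub>0 nat) set"
    using that by (induction A rule: infinite_finite_induct) (auto intro: rel_0 rel_add)
  have "rel (mp_eval (\<lambda>c. Fract (\<iota> c) 1) (\<lambda>i. Fract (num i) (den i)) p)
      (mp_eval (\<lambda>c. \<psi> (\<iota> c)) (\<lambda>i. \<psi> (num i) / \<psi> (den i)) p)"
    unfolding mp_eval_def
    by (intro rel_sum rel_mult rel_of rel_prod rel_power rel_Fract nz) (auto simp: mp_vars_def)
  then obtain r s where "0 = Fract r s" "\<psi> s \<noteq> 0"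
    "mp_eval (\<lambda>c. \<psi> (\<iota> c)) (\<lambda>i. \<psi> (num i) / \<psi> (den i)) p = \<psi> r / \<psi> s"
    unfolding zero rel_def by blast
  moreover from this have "s \<noteq> 0" by auto
  ultimately show ?thesis
    by (simp add: Zero_fract_def eq_fract)
qed

text \<open>An identity for the generic seed survives substituting actual coefficients, even from an
  extension field, as long as no denominator becomes 0.\<close>

lemma rfe_vanishing_ideal_imp_seed:
  fixes \<phi> :: "'a::field \<Rightarrow> 'b::field"
  assumes hom: "comm_ring_hom \<phi>" and p: "p \<in> rfe_vanishing_ideal k l n a"
    and deg: "Polynomial.degree g \<le> k" "Polynomial.degree h \<le> l"
    and nz: "\<And>i. i \<in> {1..n} \<Longrightarrow> poly h (\<phi> (a i)) \<noteq> 0"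
  shows "mp_eval \<phi> (\<lambda>i. poly g (\<phi> (a i)) / poly h (\<phi> (a i))) p = 0"
proof -
  interpret phi: comm_ring_hom \<phi> by fact
  \<comment> \<open>Follows the numbering of the indeterminates: numerator coefficients first,
    denominator coefficients from index \<open>k + 1\<close> on.\<close>
  define y where "y j = (if j \<le> k then coeff g j else coeff h (j - (k + 1)))" for j
  interpret ev: comm_ring_hom "mp_eval \<phi> y" by (rule comm_ring_hom_mp_eval[OF hom])
  have num: "mp_eval \<phi> y (generic_num k b) = poly g (\<phi> b)" for b
    by (simp add: generic_num_def mp_eval_sum[OF hom] mp_eval_mult[OF hom] mp_eval_const[OF hom]
        mp_eval_var[OF hom] poly_eq_sum_atMost[OF deg(1)] y_def phi.hom_power)
  have den: "mp_eval \<phi> y (generic_den k l b) = poly h (\<phi> b)" for b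
    by (simp add: generic_den_def mp_eval_sum[OF hom] mp_eval_mult[OF hom] mp_eval_const[OF hom]
        mp_eval_var[OF hom] poly_eq_sum_atMost[OF deg(2)] y_def phi.hom_power)
  have "mp_eval (\<lambda>c. mp_eval \<phi> y (mp_const c))
      (\<lambda>i. mp_eval \<phi> y (generic_num k (a i)) / mp_eval \<phi> y (generic_den k l (a i))) p = 0"
    by (rule mp_eval_Fract_specialize[of "mp_eval \<phi> y", OF ev.comm_ring_hom_axioms])
       (use p nz in \<open>auto simp: rfe_vanishing_ideal_def mem_carrier_mp_ring_iff den\<close>)
  then show ?thesis
    by (simp add: num den mp_eval_const[OF hom])
qed

text \<open>Setting the constant coefficient to 1 and all other coefficients to 0 gives the value
  1.\<close>

lemma generic_den_nonzero: "generic_den k l b \<noteq> (0 :: 'a::field mpol)"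
proof
  assume "generic_den k l b = (0 :: 'a mpol)"
  moreover have "mp_eval (\<lambda>c. c) (\<lambda>j. if j = k + 1 then 1 else 0) (generic_den k l b) =
      (\<Sum>j\<le>l. if j = 0 then 1 else 0 :: 'a)"
    unfolding generic_den_def
    unfolding mp_eval_sum[OF comm_ring_hom_ident]
    by (intro sum.cong)
       (auto simp: mp_eval_mult[OF comm_ring_hom_ident] mp_eval_const[OF comm_ring_hom_ident]
         mp_eval_var[OF comm_ring_hom_ident])
  ultimately show False
    by (simp add: mp_eval_zero[OF comm_ring_hom_ident])
qed

section \<open>The vanishing ideal contains every \<open>E\<close>\<close>

lemma ideal_rfe_vanishing_ideal: "ideal (rfe_vanishing_ideal k l n a) (mp_ring n)"
proof -
  interpret ev: comm_ring_hom "mp_eval (\<lambda>c. Fract (mp_const c) 1)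
          (\<lambda>i. Fract (generic_num k (a i)) (generic_den k l (a i)))"
    by (rule comm_ring_hom_mp_eval[OF comm_ring_hom_Fract_const])
  show ?thesis
    by (rule ideal_mp_ringI)
       (auto simp: rfe_vanishing_ideal_def mp_ring_closed ev.hom_add ev.hom_mult)
qed

lemma E_poly_in_carrier:
  assumes "set js \<subseteq> {1..n}" "length js = k + l + 2"
  shows "E_poly a k l js \<in> carrier (mp_ring n)"
proof -
  have sum: "(\<Sum>i\<in>A. f i) \<in> carrier (mp_ring n)" if "\<And>i. i \<in> A \<Longrightarrow> f i \<in> carrier (mp_ring n)"
    for A :: "(nat \<Rightarrow> nat) set" and f :: "_ \<Rightarrow> 'a mpol"
    using that by (induction A rule: infinite_finite_induct) (auto simp: mp_ring_closed)
  have prod: "(\<Prod>i\<in>A. f i) \<in> carrier (mp_ring n)" if "\<And>i. i \<in> A \<Longrightarrow> f i \<in> carrier (mp_ring n)"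
    for A :: "nat set" and f :: "_ \<Rightarrow> 'a mpol"
    using that
    by (induction A rule: infinite_finite_induct) (auto simp: mp_ring_closed, auto simp: mem_carrier_mp_ring_iff)
  have sgn: "signof \<pi> \<in> carrier (mp_ring n :: 'a mpol ring)" for \<pi> :: "nat \<Rightarrow> nat"
    by (auto simp: sign_def mem_carrier_mp_ring_iff)
  have var: "mp_var (js ! r) \<in> carrier (mp_ring n)" if "r < k + l + 2" for r
  proof -
    have "js ! r \<in> set js" using that assms by simp
    with assms show ?thesis by (auto simp: mem_carrier_mp_ring_iff mp_var_def mp_vars_def)
  qed
  define M where "M = mat (k + l + 2) (k + l + 2) (\<lambda>(r, c).
       if c \<le> l then mp_const (a (js ! r) ^ (l - c)) * mp_var (js ! r)
       else mp_const (a (js ! r) ^ (k - (c - (l + 1)))))"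
  have entry: "M $$ (r, c) \<in> carrier (mp_ring n)" if "r < k + l + 2" "c < k + l + 2" for r c
    using that unfolding M_def by (simp add: mp_ring_closed(2,4) var)
  have "det M = (\<Sum>\<pi> | \<pi> permutes {0..<k + l + 2}. signof \<pi> * (\<Prod>i = 0..<k + l + 2. M $$ (i, \<pi> i)))"
    by (rule det_def') (simp add: M_def)
  also have "\<dots> \<in> carrier (mp_ring n)"
  proof (intro sum mp_ring_closed(2) sgn prod entry)
    fix \<pi> i assume "\<pi> \<in> {\<pi>. \<pi> permutes {0..<k + l + 2}}" "i \<in> {0..<k + l + 2}"
    then have "\<pi> i \<in> {0..<k + l + 2}"
      by (simp only: mem_Collect_eq permutes_in_image)
    then show "\<pi> i < k + l + 2"
      by simp
  qed simp
  finally show ?thesis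
    unfolding E_poly_def M_def .
qed

text \<open>The generic seed itself, read as a pair of polynomials over the fraction field, supplies
  the kernel vector.\<close>

lemma E_poly_in_rfe_vanishing_ideal:
  fixes a :: "nat \<Rightarrow> 'a::field"
  assumes "set js \<subseteq> {1..n}" "length js = k + l + 2"
  shows "E_poly a k l js \<in> rfe_vanishing_ideal k l n a"
proof -
  let ?\<phi> = "\<lambda>c. Fract (mp_const c :: 'a mpol) 1"
  interpret phi: comm_ring_hom ?\<phi> by (rule comm_ring_hom_Fract_const)
  interpret fr: comm_ring_hom "\<lambda>c :: 'a mpol. Fract c 1" by (rule comm_ring_hom_Fract_one)
  interpret const: comm_ring_hom "mp_const :: 'a \<Rightarrow> 'a mpol" by (rule comm_ring_hom_mp_const)
  define g where "g = (\<Sum>j\<le>k. Polynomial.monom (Fract (mp_var j :: 'a mpol) 1) j)"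
  define h where "h = (\<Sum>j\<le>l. Polynomial.monom (Fract (mp_var (k + 1 + j) :: 'a mpol) 1) j)"
  have deg: "Polynomial.degree g \<le> k" "Polynomial.degree h \<le> l"
    unfolding g_def h_def
    by (auto intro!: degree_sum_le order.trans[OF degree_monom_le])
  have g: "poly g (?\<phi> b) = Fract (generic_num k b) 1" for b
    unfolding g_def generic_num_def poly_sum fr.hom_sum
    by (intro sum.cong) (simp_all only: poly_monom const.hom_power fr.hom_mult fr.hom_power)
  have h: "poly h (?\<phi> b) = Fract (generic_den k l b) 1" for b
    unfolding h_def generic_den_def poly_sum fr.hom_sum
    by (intro sum.cong) (simp_all only: poly_monom const.hom_power fr.hom_mult fr.hom_power)
  \<comment> \<open>The value of \<open>h\<close> at 0 is nonzero, so the kernel pair is not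
    trivial.\<close>
  have "Fract (generic_den k l (0::'a)) 1 \<noteq> 0"
    unfolding Zero_fract_def by (subst eq_fract(1)) (use generic_den_nonzero in auto)
  then have nz: "h \<noteq> 0"
    unfolding h[symmetric] by auto
  have "mp_eval ?\<phi> (\<lambda>i. Fract (generic_num k (a i)) (generic_den k l (a i))) (E_poly a k l js) = 0"
    unfolding mp_eval_E_poly_eq_0_iff[OF comm_ring_hom_Fract_const assms(2)]
    by (rule exI[of _ g], rule exI[of _ h])
       (use deg nz in \<open>auto simp only: g h generic_den_nonzero eq_fract mult_fract simp_thms
          mult_1 mult_1_right mult.commute mult_eq_0_iff one_neq_zero\<close>)
  then show ?thesis
    using E_poly_in_carrier[OF assms] by (simp add: rfe_vanishing_ideal_def)
qed

section \<open>Seeds at which a polynomial does not vanish\<close>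

text \<open>An algebraic substitute for limits, usable over any infinite field: instead of letting
  \<open>t\<close> tend to 0, one checks that the function is nonzero at 0 and moves to a generic
  \<open>t\<close>.\<close>

definition rational_on :: "'b::field set \<Rightarrow> ('b \<Rightarrow> 'b) \<Rightarrow> bool" where
  "rational_on U f \<longleftrightarrow> (\<exists>P Q. \<forall>t\<in>U. poly Q t \<noteq> 0 \<and> f t = poly P t / poly Q t)"

lemma rational_on_poly: "rational_on U (poly P)"
  unfolding rational_on_def by (rule exI[of _ P], rule exI[of _ 1]) auto

lemma rational_on_const: "rational_on U (\<lambda>t. y)"
  by (rule back_subst[of "rational_on U", OF rational_on_poly[of _ "[:y:]"]]) auto

lemma rational_on_ident: "rational_on U (\<lambda>t. t)"
  by (rule back_subst[of "rational_on U", OF rational_on_poly[of _ "[:0, 1:]"]]) auto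

lemma rational_on_diff_const: "rational_on U (\<lambda>t. y - t)"
  by (rule back_subst[of "rational_on U", OF rational_on_poly[of _ "[:y, -1:]"]]) auto

lemma rational_on_add:
  assumes "rational_on U f" "rational_on U g"
  shows "rational_on U (\<lambda>t. f t + g t)"
proof -
  obtain P Q P' Q' where "\<forall>t\<in>U. poly Q t \<noteq> 0 \<and> f t = poly P t / poly Q t"
    "\<forall>t\<in>U. poly Q' t \<noteq> 0 \<and> g t = poly P' t / poly Q' t"
    using assms unfolding rational_on_def by blast
  then have "\<forall>t\<in>U. poly (Q * Q') t \<noteq> 0 \<and> f t + g t = poly (P * Q' + P' * Q) t / poly (Q * Q') t"
    by (auto simp: field_simps)
  then show ?thesis unfolding rational_on_def by blast
qed

lemma rational_on_mult:
  assumes "rational_on U f" "rational_on U g"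
  shows "rational_on U (\<lambda>t. f t * g t)"
proof -
  obtain P Q P' Q' where "\<forall>t\<in>U. poly Q t \<noteq> 0 \<and> f t = poly P t / poly Q t"
    "\<forall>t\<in>U. poly Q' t \<noteq> 0 \<and> g t = poly P' t / poly Q' t"
    using assms unfolding rational_on_def by blast
  then have "\<forall>t\<in>U. poly (Q * Q') t \<noteq> 0 \<and> f t * g t = poly (P * P') t / poly (Q * Q') t"
    by auto
  then show ?thesis unfolding rational_on_def by blast
qed

lemma rational_on_divide:
  assumes "rational_on U f" "rational_on U g" and nz: "\<And>t. t \<in> U \<Longrightarrow> g t \<noteq> 0"
  shows "rational_on U (\<lambda>t. f t / g t)"
proof -
  obtain P Q P' Q' where "\<forall>t\<in>U. poly Q t \<noteq> 0 \<and> f t = poly P t / poly Q t"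
    "\<forall>t\<in>U. poly Q' t \<noteq> 0 \<and> g t = poly P' t / poly Q' t"
    using assms unfolding rational_on_def by blast
  with nz have "\<forall>t\<in>U. poly (Q * P') t \<noteq> 0 \<and> f t / g t = poly (P * Q') t / poly (Q * P') t"
    by fastforce
  then show ?thesis unfolding rational_on_def by blast
qed

lemma rational_on_power: "rational_on U f \<Longrightarrow> rational_on U (\<lambda>t. f t ^ e)"
  by (induction e) (auto intro: rational_on_const rational_on_mult)

lemma rational_on_prod:
  "(\<And>i. i \<in> A \<Longrightarrow> rational_on U (f i)) \<Longrightarrow> rational_on U (\<lambda>t. \<Prod>i\<in>A. f i t)"
  by (induction A rule: infinite_finite_induct) (auto intro: rational_on_const rational_on_mult)

lemma rational_on_sum:
  "(\<And>i. i \<in> A \<Longrightarrow> rational_on U (f i)) \<Longrightarrow> rational_on U (\<lambda>t. \<Sum>i\<in>A. f i t)"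
  by (induction A rule: infinite_finite_induct) (auto intro: rational_on_const rational_on_add)

text \<open>The numerator is a nonzero polynomial, so its roots together with \<open>B\<close> are
  finite; any point avoiding them lies in \<open>U\<close> because \<open>B\<close> covers the
  complement of \<open>U\<close>.\<close>

lemma rational_on_nonzero_generic:
  fixes f :: "'b::field \<Rightarrow> 'b"
  assumes "infinite (UNIV :: 'b set)" "rational_on U f" "t0 \<in> U" "f t0 \<noteq> 0" "finite B"
    and "- U \<subseteq> B"
  obtains t where "t \<in> U" "t \<notin> B" "f t \<noteq> 0"
proof -
  obtain P Q where PQ: "\<forall>t\<in>U. poly Q t \<noteq> 0 \<and> f t = poly P t / poly Q t"
    using assms(2) unfolding rational_on_def by blast
  with assms(3,4) have "P \<noteq> 0" by auto
  then have "finite (B \<union> {t. poly P t = 0})"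
    using assms(5) poly_roots_finite by blast
  then obtain t where "t \<notin> B \<union> {t. poly P t = 0}"
    using assms(1) ex_new_if_finite by blast
  moreover from this assms(6) have "t \<in> U" by auto
  ultimately show ?thesis
    using PQ by (intro that[of t]) auto
qed

text \<open>Polynomials over a field appear here as a finite set \<open>M\<close> of exponent functions with
  coefficients \<open>c\<close>; fixing the exponent of one variable is then just a function update.\<close>

lemma sum_exponent_slice:
  fixes c :: "(nat \<Rightarrow> nat) \<Rightarrow> 'b::comm_semiring_0"
  shows "(\<Sum>m\<in>(\<lambda>m. m(i := 0)) ` {m \<in> M. m i = d}. c (m(i := d)) * F m) =
    (\<Sum>m\<in>{m \<in> M. m i = d}. c m * F (m(i := 0)))"
proof -
  have "inj_on (\<lambda>m. m(i := 0)) {m \<in> M. m i = d}"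
    by (rule inj_on_inverseI[where g = "\<lambda>m. m(i := d)"]) auto
  then show ?thesis
    by (subst sum.reindex) (auto intro!: sum.cong)
qed

text \<open>Interpolation makes the values of \<open>g\<close> on \<open>C\<close> free, so this is
  the fact that a nonzero polynomial over an infinite field has a nonroot, proved one variable at a
  time. For empty \<open>C\<close> the bound \<open>card C - 1\<close> is 0.\<close>

lemma exists_nonvanishing_poly_values:
  fixes b s :: "nat \<Rightarrow> 'b::field" and c :: "(nat \<Rightarrow> nat) \<Rightarrow> 'b"
  assumes inf: "infinite (UNIV :: 'b set)"
    and "finite C" "inj_on b C" "\<And>j. j \<in> C \<Longrightarrow> s j \<noteq> 0"
    and "finite M" "M \<noteq> {}" "\<And>m. m \<in> M \<Longrightarrow> c m \<noteq> 0"
    and "\<And>m j. m \<in> M \<Longrightarrow> j \<notin> C \<Longrightarrow> m j = 0"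
  shows "\<exists>g. Polynomial.degree g \<le> card C - 1 \<and>
    (\<Sum>m\<in>M. c m * (\<Prod>j\<in>C. (s j * poly g (b j)) ^ m j)) \<noteq> 0"
  using assms(2-)
proof (induction C arbitrary: M c rule: finite_induct)
  case empty
  have "m = (\<lambda>_. 0)" if "m \<in> M" for m
    using empty.prems(6)[OF that] by auto
  with empty.prems(4) have "M = {\<lambda>_. 0}" by blast
  with empty.prems(5) show ?case
    by (intro exI[of _ 0]) simp
next
  case (insert i C)
  obtain m0 where m0: "m0 \<in> M" using insert.prems by blast
  define d where "d = m0 i"
  have "\<exists>g. Polynomial.degree g \<le> card C - 1 \<and>
    (\<Sum>m\<in>(\<lambda>m. m(i := 0)) ` {m \<in> M. m i = d}.
       c (m(i := d)) * (\<Prod>j\<in>C. (s j * poly g (b j)) ^ m j)) \<noteq> 0"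
  proof (rule insert.IH)
    show "c (m(i := d)) \<noteq> 0" if "m \<in> (\<lambda>m. m(i := 0)) ` {m \<in> M. m i = d}" for m
      using that insert.prems by auto
    show "m j = 0" if "m \<in> (\<lambda>m. m(i := 0)) ` {m \<in> M. m i = d}" "j \<notin> C" for m j
      using that insert.prems(6) by auto
  qed (use insert m0 in \<open>auto simp: d_def\<close>)
  then obtain g where g: "Polynomial.degree g \<le> card C - 1"
    and "(\<Sum>m\<in>(\<lambda>m. m(i := 0)) ` {m \<in> M. m i = d}.
       c (m(i := d)) * (\<Prod>j\<in>C. (s j * poly g (b j)) ^ m j)) \<noteq> 0"
    by blast
  then have slice: "(\<Sum>m\<in>{m \<in> M. m i = d}.
      c m * (\<Prod>j\<in>C. (s j * poly g (b j)) ^ (m(i := 0)) j)) \<noteq> 0"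
    unfolding sum_exponent_slice[where F = "\<lambda>m. \<Prod>j\<in>C. (s j * poly g (b j)) ^ m j"] by simp
  have upd: "(\<Prod>j\<in>C. (s j * poly g (b j)) ^ (m(i := 0)) j) = (\<Prod>j\<in>C. (s j * poly g (b j)) ^ m j)"
    for m :: "nat \<Rightarrow> nat"
    using insert.hyps by (intro prod.cong) auto
  \<comment> \<open>The sum as a polynomial in the value at \<open>i\<close>, with the values on
    \<open>C\<close> already fixed. Its coefficient at \<open>d\<close> is the slice made nonzero by
    induction.\<close>
  define Q where "Q = (\<Sum>m\<in>M. Polynomial.monom (c m * (\<Prod>j\<in>C. (s j * poly g (b j)) ^ m j)) (m i))"
  have "coeff Q d = (\<Sum>m\<in>M. if m i = d then c m * (\<Prod>j\<in>C. (s j * poly g (b j)) ^ m j) else 0)"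
    by (simp add: Q_def coeff_sum)
  also have "\<dots> = (\<Sum>m\<in>{m \<in> M. m i = d}. c m * (\<Prod>j\<in>C. (s j * poly g (b j)) ^ m j))"
    using insert.prems by (simp add: sum.inter_filter)
  finally have "Q \<noteq> 0"
    using slice upd by auto
  then obtain z where z: "poly Q z \<noteq> 0"
    using inf poly_roots_finite[of Q] ex_new_if_finite[of "{z. poly Q z = 0}"] by blast
  define W where "W = (\<Prod>j\<in>C. [:- b j, 1:])"
  have "b i \<noteq> b j" if "j \<in> C" for j
    using insert.prems(1) insert.hyps(2) that by (auto simp: inj_on_def)
  then have w: "poly W (b i) \<noteq> 0"
    using insert.hyps by (simp add: W_def poly_prod)
  have W0: "poly W (b j) = 0" if "j \<in> C" for j
    using insert.hyps that by (auto simp: W_def poly_prod)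
  \<comment> \<open>Since \<open>W\<close> vanishes on \<open>C\<close>, adding a multiple of it
    keeps the values there; this multiple moves the scaled value at \<open>b i\<close> to the
    nonroot \<open>z\<close>.\<close>
  define y where "y = (z / s i - poly g (b i)) / poly W (b i)"
  define g' where "g' = g + smult y W"
  have degW: "Polynomial.degree W = card C"
    unfolding W_def by (subst degree_prod_eq_sum_degree) auto
  have "Polynomial.degree g' \<le> card C"
    unfolding g'_def
    by (rule degree_add_le) (use g degW degree_smult_le[of y W] in auto)
  moreover have "s i * poly g' (b i) = z"
    using w insert.prems(2)[of i] by (simp add: g'_def y_def field_simps)
  moreover have "poly g' (b j) = poly g (b j)" if "j \<in> C" for j
    using that by (simp add: g'_def W0)
  ultimately have "Polynomial.degree g' \<le> card (insert i C) - 1"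
    "(\<Sum>m\<in>M. c m * (\<Prod>j\<in>insert i C. (s j * poly g' (b j)) ^ m j)) = poly Q z"
    using insert.hyps
    by (auto simp: Q_def poly_sum poly_monom mult_ac intro!: sum.cong prod.cong)
  with z show ?case by metis
qed

text \<open>Starting from values on \<open>C\<close>, a generic constant is added to
  \<open>g\<close> so that no value on \<open>V\<close> is 0. The later pole construction relies on
  this, since a zero value cannot be sent to infinity.\<close>

lemma exists_nonvanishing_poly_seed:
  fixes b s :: "nat \<Rightarrow> 'b::field" and c :: "(nat \<Rightarrow> nat) \<Rightarrow> 'b"
  assumes inf: "infinite (UNIV :: 'b set)"
    and V: "finite V" "inj_on b V" and C: "C \<subseteq> V" "card C \<le> k + 1"
    and s: "\<And>j. j \<in> V \<Longrightarrow> s j \<noteq> 0"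
    and M: "finite M" "M \<noteq> {}" "\<And>m. m \<in> M \<Longrightarrow> c m \<noteq> 0"
    and supp: "\<And>m j. m \<in> M \<Longrightarrow> j \<notin> C \<Longrightarrow> m j = 0"
  shows "\<exists>g. Polynomial.degree g \<le> k \<and> (\<forall>j\<in>V. poly g (b j) \<noteq> 0) \<and>
    (\<Sum>m\<in>M. c m * (\<Prod>j\<in>V. (s j * poly g (b j)) ^ m j)) \<noteq> 0"
proof -
  have "finite C" "inj_on b C"
    using V C finite_subset inj_on_subset by blast+
  moreover have "s j \<noteq> 0" if "j \<in> C" for j
    using s C(1) that by blast
  ultimately have "\<exists>g. Polynomial.degree g \<le> card C - 1 \<and>
      (\<Sum>m\<in>M. c m * (\<Prod>j\<in>C. (s j * poly g (b j)) ^ m j)) \<noteq> 0"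
    by (intro exists_nonvanishing_poly_values[OF inf] M supp)
  then obtain g where g: "Polynomial.degree g \<le> card C - 1"
    "(\<Sum>m\<in>M. c m * (\<Prod>j\<in>C. (s j * poly g (b j)) ^ m j)) \<noteq> 0"
    by blast
  have CV: "(\<Prod>j\<in>C. (s j * poly g (b j)) ^ m j) = (\<Prod>j\<in>V. (s j * poly g (b j)) ^ m j)"
    if "m \<in> M" for m
    by (rule prod.mono_neutral_left) (use V(1) C(1) supp[OF that] in auto)
  \<comment> \<open>The sum for \<open>g + t\<close>; it is nonzero at \<open>t = 0\<close>, hence
    also at some \<open>t\<close> outside the finitely many values that give \<open>g + t\<close> a
    zero on \<open>V\<close>.\<close>
  define f where "f t = (\<Sum>m\<in>M. c m * (\<Prod>j\<in>V. (s j * (poly g (b j) + t)) ^ m j))" for t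
  have rat: "rational_on UNIV f"
    unfolding f_def
    by (intro rational_on_sum rational_on_mult rational_on_prod rational_on_power rational_on_add
        rational_on_const rational_on_ident)
  have f0: "f 0 \<noteq> 0"
    using g(2) CV by (simp add: f_def cong: sum.cong)
  obtain t where t: "t \<notin> (\<lambda>j. - poly g (b j)) ` V" "f t \<noteq> 0"
    by (rule rational_on_nonzero_generic[OF inf rat, of 0 "(\<lambda>j. - poly g (b j)) ` V"])
       (use f0 V in auto)
  show ?thesis
  proof (intro exI[of _ "g + [:t:]"] conjI ballI)
    show "Polynomial.degree (g + [:t:]) \<le> k"
      by (rule degree_add_le) (use g(1) C in auto)
    show "poly (g + [:t:]) (b j) \<noteq> 0" if "j \<in> V" for j
      using t(1) that by (auto simp: add_eq_0_iff)
    show "(\<Sum>m\<in>M. c m * (\<Prod>j\<in>V. (s j * poly (g + [:t:]) (b j)) ^ m j)) \<noteq> 0"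
      using t(2) by (simp add: f_def)
  qed
qed

text \<open>Multiplying the denominator by \<open>\<alpha> - b\<^sub>i - \<epsilon>\<close> sends the value at \<open>b\<^sub>i\<close> to infinity as
  \<open>\<epsilon>\<close> tends to 0, so that the top power of the \<open>i\<close>-th variable dominates. Its coefficient involves
  one variable less outside \<open>C\<close> and is evaluated at the old values divided by \<open>b\<^sub>j - b\<^sub>i\<close>;
  the scaling \<open>s\<close> absorbs this.\<close>

lemma exists_nonvanishing_seed_scaled:
  fixes b :: "nat \<Rightarrow> 'b::field"
  assumes inf: "infinite (UNIV :: 'b set)"
    and V: "finite V" "inj_on b V" and C: "C \<subseteq> V" "card C \<le> k + 1"
    and "\<And>j. j \<in> V \<Longrightarrow> s j \<noteq> 0"
    and "finite M" "M \<noteq> {}" "\<And>m. m \<in> M \<Longrightarrow> c m \<noteq> 0"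
    and "\<And>m j. m \<in> M \<Longrightarrow> j \<notin> V \<Longrightarrow> m j = 0"
    and "\<And>m. m \<in> M \<Longrightarrow> card {j \<in> V - C. m j \<noteq> 0} \<le> l"
  shows "\<exists>g h. Polynomial.degree g \<le> k \<and> Polynomial.degree h \<le> l \<and> h \<noteq> 0 \<and>
    (\<forall>j\<in>V. poly g (b j) \<noteq> 0 \<and> poly h (b j) \<noteq> 0) \<and>
    (\<Sum>m\<in>M. c m * (\<Prod>j\<in>V. (s j * poly g (b j) / poly h (b j)) ^ m j)) \<noteq> 0"
  using assms(6-)
proof (induction l arbitrary: M c s)
  case (0 M c s)
  have "m j = 0" if "m \<in> M" "j \<notin> C" for m j
  proof -
    have "finite {j \<in> V - C. m j \<noteq> 0}" using V by simp
    then have "{j \<in> V - C. m j \<noteq> 0} = {}"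
      using 0(6)[OF that(1)] by (simp only: le_zero_eq card_0_eq)
    with 0(5)[of m j] that show ?thesis by auto
  qed
  then have "\<exists>g. Polynomial.degree g \<le> k \<and> (\<forall>j\<in>V. poly g (b j) \<noteq> 0) \<and>
      (\<Sum>m\<in>M. c m * (\<Prod>j\<in>V. (s j * poly g (b j)) ^ m j)) \<noteq> 0"
    by (intro exists_nonvanishing_poly_seed[OF inf V C] 0(1-4))
  then obtain g where "Polynomial.degree g \<le> k" "\<forall>j\<in>V. poly g (b j) \<noteq> 0"
    "(\<Sum>m\<in>M. c m * (\<Prod>j\<in>V. (s j * poly g (b j)) ^ m j)) \<noteq> 0"
    by blast
  then show ?case
    by (intro exI[of _ g] exI[of _ 1]) simp
next
  case (Suc l M c s)
  show ?case
  proof (cases "\<forall>m\<in>M. \<forall>j. j \<notin> C \<longrightarrow> m j = 0")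
    case True
    then have "m j = 0" if "m \<in> M" "j \<notin> C" for m j
      using that by blast
    then have "\<exists>g. Polynomial.degree g \<le> k \<and> (\<forall>j\<in>V. poly g (b j) \<noteq> 0) \<and>
        (\<Sum>m\<in>M. c m * (\<Prod>j\<in>V. (s j * poly g (b j)) ^ m j)) \<noteq> 0"
      by (intro exists_nonvanishing_poly_seed[OF inf V C] Suc.prems(1-4))
    then obtain g where "Polynomial.degree g \<le> k" "\<forall>j\<in>V. poly g (b j) \<noteq> 0"
      "(\<Sum>m\<in>M. c m * (\<Prod>j\<in>V. (s j * poly g (b j)) ^ m j)) \<noteq> 0"
      by blast
    then show ?thesis
      by (intro exI[of _ g] exI[of _ 1]) simp
  next
    case False
    then obtain m1 i where m1: "m1 \<in> M" "i \<notin> C" "m1 i \<noteq> 0" by blast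
    with Suc.prems(5)[of m1 i] have i: "i \<in> V - C" by auto
    \<comment> \<open>The top exponent of variable \<open>i\<close>. As it is positive, every
      monomial attaining it loses a variable outside \<open>C\<close> when that exponent is set to
      0, which is what the induction on \<open>l\<close> consumes.\<close>
    define d where "d = Max ((\<lambda>m. m i) ` M)"
    have le_d: "m i \<le> d" if "m \<in> M" for m
      using that Suc.prems(2) by (simp add: d_def)
    have "d \<in> (\<lambda>m. m i) ` M"
      unfolding d_def using Suc.prems(2,3) by (intro Max_in) auto
    then obtain m0 where m0: "m0 \<in> M" "m0 i = d" by blast
    have d: "d > 0" using le_d[OF m1(1)] m1(3) by simp
    define M' where "M' = (\<lambda>m. m(i := 0)) ` {m \<in> M. m i = d}"
    \<comment> \<open>For \<open>j\<close> other than \<open>i\<close>, the new denominator factor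
      tends to \<open>b j - b i\<close>, which the scaling anticipates. At \<open>i\<close> the
      exponents in \<open>M'\<close> are 0, so 1 is just a nonzero default.\<close>
    define s' where "s' j = (if j = i then 1 else s j / (b j - b i))" for j
    have b: "b j \<noteq> b i" if "j \<in> V - {i}" for j
      using V(2) i that by (auto simp: inj_on_def)
    have "\<exists>g h. Polynomial.degree g \<le> k \<and> Polynomial.degree h \<le> l \<and> h \<noteq> 0 \<and>
      (\<forall>j\<in>V. poly g (b j) \<noteq> 0 \<and> poly h (b j) \<noteq> 0) \<and>
      (\<Sum>m\<in>M'. c (m(i := d)) * (\<Prod>j\<in>V. (s' j * poly g (b j) / poly h (b j)) ^ m j)) \<noteq> 0"
    proof (rule Suc.IH)
      show "s' j \<noteq> 0" if "j \<in> V" for j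
        using b that Suc.prems(1) by (auto simp: s'_def)
      show "finite M'" "M' \<noteq> {}"
        using Suc.prems(2) m0 by (auto simp: M'_def)
      show "c (m(i := d)) \<noteq> 0" if "m \<in> M'" for m
        using that Suc.prems(4) by (auto simp: M'_def)
      show "m j = 0" if "m \<in> M'" "j \<notin> V" for m j
        using that Suc.prems(5) by (auto simp: M'_def)
      show "card {j \<in> V - C. m j \<noteq> 0} \<le> l" if m: "m \<in> M'" for m
      proof -
        obtain m' where m': "m' \<in> M" "m' i = d" "m = m'(i := 0)"
          using m by (auto simp: M'_def)
        then have "{j \<in> V - C. m j \<noteq> 0} = {j \<in> V - C. m' j \<noteq> 0} - {i}"
          by auto
        moreover have "i \<in> {j \<in> V - C. m' j \<noteq> 0}" "finite {j \<in> V - C. m' j \<noteq> 0}"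
          using i d m' V by auto
        ultimately show ?thesis
          using Suc.prems(6)[OF m'(1)] by simp
      qed
    qed
    then obtain g h where gh: "Polynomial.degree g \<le> k" "Polynomial.degree h \<le> l" "h \<noteq> 0"
      and gh0: "\<And>j. j \<in> V \<Longrightarrow> poly g (b j) \<noteq> 0 \<and> poly h (b j) \<noteq> 0"
      and lead: "(\<Sum>m\<in>M'. c (m(i := d)) *
        (\<Prod>j\<in>V. (s' j * poly g (b j) / poly h (b j)) ^ m j)) \<noteq> 0"
      by blast
    define u where "u j = s j * poly g (b j) / poly h (b j)" for j
    have u: "u i \<noteq> 0"
      using gh0[of i] Suc.prems(1)[of i] i by (simp add: u_def)
    define U where "U = {t. \<forall>j\<in>V - {i}. b j - b i - t \<noteq> 0}"
    \<comment> \<open>This is \<open>t ^ d\<close> times the sum for the denominator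
      \<open>h\<close> multiplied by \<open>\<alpha> - b i - t\<close>. At \<open>b i\<close> the
      new factor is \<open>-t\<close>, and \<open>t ^ d\<close> clears the resulting poles, so
      \<open>R\<close> is defined at 0.\<close>
    define R where "R t = (\<Sum>m\<in>M. c m * (- u i) ^ m i * t ^ (d - m i) *
      (\<Prod>j\<in>V - {i}. (u j / (b j - b i - t)) ^ m j))" for t
    have rat: "rational_on U R"
      unfolding R_def
      by (intro rational_on_sum rational_on_mult rational_on_prod rational_on_power
          rational_on_divide rational_on_diff_const rational_on_const rational_on_ident)
         (auto simp: U_def)
    \<comment> \<open>At 0 only the monomials with top exponent \<open>d\<close> survive, through
      \<open>0 ^ 0 = 1\<close>.\<close>
    have "R 0 = (\<Sum>m\<in>M. if m i = d then
        c m * (- u i) ^ d * (\<Prod>j\<in>V - {i}. (u j / (b j - b i)) ^ m j) else 0)"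
      unfolding R_def
    proof (rule sum.cong[OF refl])
      fix m assume "m \<in> M"
      then have "m i \<noteq> d \<Longrightarrow> d - m i \<noteq> 0"
        using le_d[of m] by simp
      then show "c m * (- u i) ^ m i * 0 ^ (d - m i) *
          (\<Prod>j\<in>V - {i}. (u j / (b j - b i - 0)) ^ m j) =
        (if m i = d then c m * (- u i) ^ d * (\<Prod>j\<in>V - {i}. (u j / (b j - b i)) ^ m j) else 0)"
        by auto
    qed
    also have "\<dots> = (\<Sum>m\<in>{m \<in> M. m i = d}.
        c m * (- u i) ^ d * (\<Prod>j\<in>V - {i}. (u j / (b j - b i)) ^ m j))"
      using Suc.prems(2) by (simp add: sum.inter_filter)
    also have "\<dots> = (- u i) ^ d * (\<Sum>m\<in>{m \<in> M. m i = d}.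
        c m * (\<Prod>j\<in>V - {i}. (u j / (b j - b i)) ^ m j))"
      by (simp add: sum_distrib_left mult_ac)
    also have "(\<Sum>m\<in>{m \<in> M. m i = d}. c m * (\<Prod>j\<in>V - {i}. (u j / (b j - b i)) ^ m j)) =
      (\<Sum>m\<in>{m \<in> M. m i = d}. c m *
        (\<Prod>j\<in>V. (s' j * poly g (b j) / poly h (b j)) ^ (m(i := 0)) j))"
    proof (intro sum.cong refl arg_cong2[of _ _ _ _ "(*)"])
      fix m
      have "(\<Prod>j\<in>V. (s' j * poly g (b j) / poly h (b j)) ^ (m(i := 0)) j) =
          (\<Prod>j\<in>V - {i}. (s' j * poly g (b j) / poly h (b j)) ^ (m(i := 0)) j)"
        using i V(1) by (subst prod.remove[of V i]) auto
      also have "\<dots> = (\<Prod>j\<in>V - {i}. (u j / (b j - b i)) ^ m j)"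
        by (rule prod.cong) (auto simp: s'_def u_def mult_ac)
      finally show "(\<Prod>j\<in>V - {i}. (u j / (b j - b i)) ^ m j) =
        (\<Prod>j\<in>V. (s' j * poly g (b j) / poly h (b j)) ^ (m(i := 0)) j)" ..
    qed
    also have "\<dots> = (\<Sum>m\<in>M'. c (m(i := d)) *
        (\<Prod>j\<in>V. (s' j * poly g (b j) / poly h (b j)) ^ m j))"
      unfolding M'_def by (rule sum_exponent_slice[symmetric])
    finally have R0: "R 0 \<noteq> 0"
      using lead u by simp
    have "0 \<in> U" using b by (auto simp: U_def)
    \<comment> \<open>The excluded values include 0, from \<open>j = i\<close>; avoiding all of them
      keeps the new denominator nonzero on \<open>V\<close>.\<close>
    then obtain t where t: "t \<notin> (\<lambda>j. b j - b i) ` V" "R t \<noteq> 0"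
      by (rule rational_on_nonzero_generic[OF inf rat, of 0 "(\<lambda>j. b j - b i) ` V"])
         (use R0 V in \<open>auto simp: U_def\<close>)
    have t0: "t \<noteq> 0" using t(1) i by auto
    define h' where "h' = h * [:- b i - t, 1:]"
    have h': "poly h' (b j) = poly h (b j) * (b j - b i - t)" for j
      by (simp add: h'_def algebra_simps)
    have "t ^ d * (\<Sum>m\<in>M. c m * (\<Prod>j\<in>V. (s j * poly g (b j) / poly h' (b j)) ^ m j)) = R t"
      unfolding R_def sum_distrib_left
    proof (rule sum.cong[OF refl])
      fix m assume m: "m \<in> M"
      have "(\<Prod>j\<in>V. (s j * poly g (b j) / poly h' (b j)) ^ m j) =
          (\<Prod>j\<in>V. (u j / (b j - b i - t)) ^ m j)"
        by (simp add: h' u_def)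
      also have "\<dots> = (- u i / t) ^ m i * (\<Prod>j\<in>V - {i}. (u j / (b j - b i - t)) ^ m j)"
        using i V(1) by (subst prod.remove[of V i]) auto
      finally show "t ^ d * (c m * (\<Prod>j\<in>V. (s j * poly g (b j) / poly h' (b j)) ^ m j)) =
        c m * (- u i) ^ m i * t ^ (d - m i) * (\<Prod>j\<in>V - {i}. (u j / (b j - b i - t)) ^ m j)"
        using t0 le_d[OF m] by (simp only: power_divide) (simp add: power_diff)
    qed
    with t(2) have "(\<Sum>m\<in>M. c m * (\<Prod>j\<in>V. (s j * poly g (b j) / poly h' (b j)) ^ m j)) \<noteq> 0"
      by auto
    moreover have "Polynomial.degree h' \<le> Suc l"
      unfolding h'_def using gh(2) by (intro order.trans[OF degree_mult_le]) simp
    moreover have "h' \<noteq> 0"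
      using gh(3) unfolding h'_def mult_eq_0_iff by simp
    moreover have "poly g (b j) \<noteq> 0 \<and> poly h' (b j) \<noteq> 0" if "j \<in> V" for j
      using gh0[OF that] t(1) that by (auto simp: h')
    ultimately show ?thesis
      using gh(1) by blast
  qed
qed

lemma comm_ring_hom_field_eq_0_iff:
  fixes \<phi> :: "'a::field \<Rightarrow> 'b::field"
  assumes "comm_ring_hom \<phi>"
  shows "\<phi> x = 0 \<longleftrightarrow> x = 0"
proof -
  interpret comm_ring_hom \<phi> by fact
  have "x \<noteq> 0 \<Longrightarrow> \<phi> x * \<phi> (inverse x) = 1"
    by (simp flip: hom_mult)
  then show ?thesis by force
qed

text \<open>Transfers the existence of a good seed to formal polynomials. The seed lives over an
  infinite extension field, so the field of coefficients may be finite.\<close>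

lemma exists_nonvanishing_seed:
  fixes \<phi> :: "'a::field \<Rightarrow> 'b::field" and a :: "nat \<Rightarrow> 'a"
  assumes hom: "comm_ring_hom \<phi>" and inf: "infinite (UNIV :: 'b set)"
    and inj: "inj_on a {1..n}" and C: "C \<subseteq> {1..n}" "card C \<le> k + 1"
    and p: "p \<in> carrier (mp_ring n)" "p \<noteq> 0"
    and out: "\<And>m. m \<in> Poly_Mapping.keys p \<Longrightarrow> card (Poly_Mapping.keys m - C) \<le> l"
  shows "\<exists>g h. Polynomial.degree g \<le> k \<and> Polynomial.degree h \<le> l \<and> h \<noteq> 0 \<and>
    (\<forall>i\<in>{1..n}. poly h (\<phi> (a i)) \<noteq> 0) \<and>
    mp_eval \<phi> (\<lambda>i. poly g (\<phi> (a i)) / poly h (\<phi> (a i))) p \<noteq> 0"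
proof -
  interpret comm_ring_hom \<phi> by fact
  let ?V = "{1..n}"
  \<comment> \<open>Monomials are replaced by their exponent functions, which determine them;
    \<open>c\<close> recovers the monomial to look up its coefficient.\<close>
  define M where "M = Poly_Mapping.lookup ` Poly_Mapping.keys p"
  define c where "c f = \<phi> (Poly_Mapping.lookup p (Abs_poly_mapping f))" for f
  have keys: "Poly_Mapping.keys m \<subseteq> ?V" if "m \<in> Poly_Mapping.keys p" for m
    using p(1) that by (auto simp: mem_carrier_mp_ring_iff mp_vars_def)
  have "\<exists>g h. Polynomial.degree g \<le> k \<and> Polynomial.degree h \<le> l \<and> h \<noteq> 0 \<and>
    (\<forall>j\<in>?V. poly g (\<phi> (a j)) \<noteq> 0 \<and> poly h (\<phi> (a j)) \<noteq> 0) \<and>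
    (\<Sum>m\<in>M. c m * (\<Prod>j\<in>?V. (1 * poly g (\<phi> (a j)) / poly h (\<phi> (a j))) ^ m j)) \<noteq> 0"
  proof (rule exists_nonvanishing_seed_scaled[where b = "\<lambda>j. \<phi> (a j)" and s = "\<lambda>_. 1",
        OF inf _ _ C])
    show "inj_on (\<lambda>j. \<phi> (a j)) ?V"
    proof (rule inj_onI)
      fix i j assume ij: "i \<in> ?V" "j \<in> ?V" "\<phi> (a i) = \<phi> (a j)"
      then have "\<phi> (a i - a j) = 0"
        by (simp add: hom_minus)
      then have "a i = a j"
        by (simp add: comm_ring_hom_field_eq_0_iff[OF hom])
      from inj_onD[OF inj this ij(1,2)] show "i = j" .
    qed
    show "finite M" "M \<noteq> {}"
      using p(2) by (auto simp: M_def)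
    show "c f \<noteq> 0" if "f \<in> M" for f
      using that by (auto simp: M_def c_def lookup_inverse comm_ring_hom_field_eq_0_iff[OF hom]
          in_keys_iff)
    show "f j = 0" if "f \<in> M" "j \<notin> ?V" for f j
      using that keys by (force simp: M_def in_keys_iff)
    show "card {j \<in> ?V - C. f j \<noteq> 0} \<le> l" if f: "f \<in> M" for f
    proof -
      obtain m where m: "m \<in> Poly_Mapping.keys p" "f = Poly_Mapping.lookup m"
        using f by (auto simp: M_def)
      then have "{j \<in> ?V - C. f j \<noteq> 0} = Poly_Mapping.keys m - C"
        using keys[OF m(1)] by (auto simp: in_keys_iff)
      with out[OF m(1)] show ?thesis by simp
    qed
  qed auto
  then obtain g h where gh: "Polynomial.degree g \<le> k" "Polynomial.degree h \<le> l" "h \<noteq> 0"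
    "\<forall>j\<in>?V. poly h (\<phi> (a j)) \<noteq> 0"
    "(\<Sum>m\<in>M. c m * (\<Prod>j\<in>?V. (poly g (\<phi> (a j)) / poly h (\<phi> (a j))) ^ m j)) \<noteq> 0"
    by auto
  have "inj_on Poly_Mapping.lookup (Poly_Mapping.keys p)"
    by (rule inj_onI) (simp only: lookup_inject)
  then have "(\<Sum>m\<in>M. c m * (\<Prod>j\<in>?V. (poly g (\<phi> (a j)) / poly h (\<phi> (a j))) ^ m j)) =
    (\<Sum>m\<in>Poly_Mapping.keys p. \<phi> (Poly_Mapping.lookup p m) *
      (\<Prod>j\<in>?V. (poly g (\<phi> (a j)) / poly h (\<phi> (a j))) ^ Poly_Mapping.lookup m j))"
    unfolding M_def by (subst sum.reindex) (simp_all add: c_def lookup_inverse)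
  also have "\<dots> = mp_eval \<phi> (\<lambda>i. poly g (\<phi> (a i)) / poly h (\<phi> (a i))) p"
    unfolding mp_eval_def monom_val_def[symmetric]
    by (intro sum.cong) (simp_all add: monom_val_superset[OF _ keys])
  finally show ?thesis
    using gh by auto
qed

section \<open>Reduction modulo the polynomials \<open>E\<close>\<close>

lemma poly_eq_0_if_many_roots:
  fixes p :: "'a::idom poly"
  assumes "inj_on a A" "finite A" "Polynomial.degree p < card A"
    and "\<And>i. i \<in> A \<Longrightarrow> poly p (a i) = 0"
  shows "p = 0"
proof (rule ccontr)
  assume "p \<noteq> 0"
  then have "card (a ` A) \<le> card {x. poly p x = 0}"
    using assms poly_roots_finite[of p] by (intro card_mono) auto
  also have "\<dots> \<le> Polynomial.degree p"
    using \<open>p \<noteq> 0\<close> by (rule card_poly_roots_bound)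
  finally show False
    using assms by (simp add: card_image)
qed

text \<open>For a kernel pair at this point, \<open>g\<close> vanishes at the \<open>k + 1\<close>
  abscissas outside \<open>S\<close> and is therefore 0; then \<open>h\<close> vanishes at the
  \<open>l + 1\<close> abscissas of \<open>S\<close> and is 0 as well.\<close>

lemma E_poly_indicator_nonzero:
  fixes a :: "nat \<Rightarrow> 'a::field"
  assumes inj: "inj_on a (set js)" and js: "distinct js" "length js = k + l + 2"
    and S: "S \<subseteq> set js" "card S = l + 1"
  shows "mp_eval (\<lambda>c. c) (\<lambda>i. if i \<in> S then 1 else 0) (E_poly a k l js) \<noteq> 0"
proof
  assume "mp_eval (\<lambda>c. c) (\<lambda>i. if i \<in> S then 1 else 0) (E_poly a k l js) = 0"
  then obtain g h where deg: "Polynomial.degree g \<le> k" "Polynomial.degree h \<le> l"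
    and nz: "g \<noteq> 0 \<or> h \<noteq> 0"
    and eq: "\<And>i. i \<in> set js \<Longrightarrow> poly h (a i) * (if i \<in> S then 1 else 0) = poly g (a i)"
    unfolding mp_eval_E_poly_eq_0_iff[OF comm_ring_hom_ident js(2)] by blast
  have "finite S" using S(1) by (rule finite_subset) simp
  have "card (set js - S) = k + 1"
    using S js \<open>finite S\<close> by (simp add: card_Diff_subset distinct_card)
  moreover have "poly g (a i) = 0" if "i \<in> set js - S" for i
    using eq[of i] that by simp
  moreover have "inj_on a (set js - S)" "inj_on a S"
    using inj S(1) by (auto intro: inj_on_subset)
  ultimately have "g = 0"
    using deg by (intro poly_eq_0_if_many_roots[of a "set js - S"]) auto
  moreover have "h = 0"
  proof (rule poly_eq_0_if_many_roots[of a S])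
    show "poly h (a i) = 0" if "i \<in> S" for i
      using eq[of i] that S(1) \<open>g = 0\<close> by auto
  qed (use \<open>inj_on a S\<close> \<open>finite S\<close> deg S in auto)
  ultimately show False
    using nz by blast
qed

text \<open>With at most \<open>l\<close> ones among the chosen indices, \<open>g = 0\<close> and a
  nonzero \<open>h\<close> vanishing at their abscissas form a kernel pair.\<close>

lemma E_poly_indicator_zero:
  fixes a :: "nat \<Rightarrow> 'a::field"
  assumes "length js = k + l + 2" "card (set js \<inter> S) \<le> l"
  shows "mp_eval (\<lambda>c. c) (\<lambda>i. if i \<in> S then 1 else 0) (E_poly a k l js) = 0"
proof -
  define h where "h = (\<Prod>i\<in>set js \<inter> S. [:- a i, 1:])"
  have "Polynomial.degree h \<le> l"
    unfolding h_def using assms(2) by (subst degree_prod_eq_sum_degree) auto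
  moreover have "h \<noteq> 0"
    by (simp add: h_def)
  moreover have "poly h (a i) = 0" if "i \<in> set js" "i \<in> S" for i
    using that by (auto simp: h_def poly_prod)
  ultimately show ?thesis
    unfolding mp_eval_E_poly_eq_0_iff[OF comm_ring_hom_ident assms(1)]
    by (intro exI[of _ 0] exI[of _ h]) auto
qed

text \<open>A division algorithm with induction on the degree outside \<open>C\<close>. A monomial
  with more than \<open>l\<close> variables outside \<open>C\<close> is divisible by some
  \<open>x_S\<close>, and \<open>E\<close> for \<open>C \<union> S\<close> rewrites
  \<open>x_S\<close> into monomials of smaller degree outside \<open>C\<close>.\<close>

lemma reduce_modulo_E_polys:
  fixes a :: "nat \<Rightarrow> 'a::field"
  assumes inj: "inj_on a {1..n}" and C: "C \<subseteq> {1..n}" "card C = k + 1"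
    and J: "ideal J (mp_ring n)"
    and EJ: "\<And>js. length js = k + l + 2 \<Longrightarrow> set js \<subseteq> {1..n} \<Longrightarrow> sorted_wrt (<) js \<Longrightarrow>
      C \<subseteq> set js \<Longrightarrow> E_poly a k l js \<in> J"
    and p: "p \<in> carrier (mp_ring n)"
  shows "\<exists>q\<in>carrier (mp_ring n). p - q \<in> J \<and>
    (\<forall>m\<in>Poly_Mapping.keys q. card (Poly_Mapping.keys m - C) \<le> l)"
proof -
  note J_closed = ideal_mp_ringD[OF J]
  define reducible where "reducible p \<longleftrightarrow> (\<exists>q\<in>carrier (mp_ring n). p - q \<in> J \<and>
    (\<forall>m\<in>Poly_Mapping.keys q. card (Poly_Mapping.keys m - C) \<le> l))" for p
  have red_0: "reducible 0"
    unfolding reducible_def using J_closed(2) by (intro bexI[of _ 0]) (auto simp: mp_ring_closed)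
  have red_add: "reducible (p + p')" if red: "reducible p" "reducible p'" for p p'
  proof -
    obtain q q' where q: "q \<in> carrier (mp_ring n)" "p - q \<in> J"
      "\<forall>m\<in>Poly_Mapping.keys q. card (Poly_Mapping.keys m - C) \<le> l"
      and q': "q' \<in> carrier (mp_ring n)" "p' - q' \<in> J"
      "\<forall>m\<in>Poly_Mapping.keys q'. card (Poly_Mapping.keys m - C) \<le> l"
      using red unfolding reducible_def by blast
    have "(p - q) + (p' - q') \<in> J"
      using q q' by (intro J_closed(3))
    moreover have "(p - q) + (p' - q') = (p + p') - (q + q')" by simp
    moreover have "\<forall>m\<in>Poly_Mapping.keys (q + q'). card (Poly_Mapping.keys m - C) \<le> l"
      using q(3) q'(3) Poly_Mapping.keys_add[of q q'] by blast
    ultimately show ?thesis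
      unfolding reducible_def using mp_ring_closed(1)[OF q(1) q'(1)] by auto
  qed
  have red_sum: "reducible (\<Sum>i\<in>A. f i)" if "\<And>i. i \<in> A \<Longrightarrow> reducible (f i)"
    for A :: "'i set" and f
    using that by (induction A rule: infinite_finite_induct) (auto intro: red_0 red_add)
  define outdeg where "outdeg m = (\<Sum>i\<in>{1..n} - C. Poly_Mapping.lookup m i)" for m :: "nat \<Rightarrow>\<^sub>0 nat"
  have outdeg_add: "outdeg (m + m') = outdeg m + outdeg m'" for m m'
    by (simp add: outdeg_def lookup_add sum.distrib)
  have outdeg_sqf: "outdeg (squarefree_monom T) = card (T - C)" if "T \<subseteq> {1..n}" for T
  proof -
    have "finite T" using that by (rule finite_subset) simp
    then have "outdeg (squarefree_monom T) = (\<Sum>i\<in>{1..n} - C. if i \<in> T then 1 else 0)"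
      by (simp add: outdeg_def lookup_squarefree_monom)
    also have "\<dots> = card (({1..n} - C) \<inter> T)"
      by (simp add: sum.If_cases)
    also have "({1..n} - C) \<inter> T = T - C"
      using that by auto
    finally show ?thesis .
  qed
  have red_single: "reducible (Poly_Mapping.single m c)" if "Poly_Mapping.keys m \<subseteq> {1..n}" for m c
    using that
  proof (induction "outdeg m" arbitrary: m c rule: less_induct)
    case (less m c)
    show ?case
    proof (cases "card (Poly_Mapping.keys m - C) \<le> l")
      case True
      then show ?thesis
        unfolding reducible_def using less.prems J_closed(2)
        by (intro bexI[of _ "Poly_Mapping.single m c"])
           (auto simp: mem_carrier_mp_ring_iff mp_vars_def)
    next
      case False
      then obtain S where S: "S \<subseteq> Poly_Mapping.keys m - C" "card S = l + 1" "finite S"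
        using obtain_subset_with_card_n[of "l + 1" "Poly_Mapping.keys m - C"] by auto
      have "finite C" using C(1) by (rule finite_subset) simp
      define js where "js = sorted_list_of_set (C \<union> S)"
      have set_js: "set js = C \<union> S"
        using \<open>finite C\<close> S(3) by (simp add: js_def)
      have js: "distinct js" "sorted_wrt (<) js"
        by (simp_all add: js_def)
      have "length js = card (C \<union> S)"
        by (simp add: js_def)
      also have "\<dots> = k + l + 2"
        using S C \<open>finite C\<close> by (subst card_Un_disjoint) auto
      finally have len: "length js = k + l + 2" .
      have sub: "set js \<subseteq> {1..n}"
        using C(1) S(1) less.prems by (auto simp: set_js)
      let ?A = "{T. T \<subseteq> set js \<and> card T = l + 1}"
      obtain e where e: "E_poly a k l js = (\<Sum>T\<in>?A. Poly_Mapping.single (squarefree_monom T) (e T))"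
        using E_poly_expansion[OF js(1) len] by blast
      have finA: "finite ?A"
        by simp
      have S_A: "S \<in> ?A"
        using S set_js by simp
      have finT: "finite T" if "T \<in> ?A" for T
        using that finite_subset[of T "set js"] by auto
      \<comment> \<open>Evaluation at the indicator of \<open>S\<close> reads off the coefficient of
        \<open>x_S\<close>: no other set of the same size is contained in \<open>S\<close>.\<close>
      have "mp_eval (\<lambda>c. c) (\<lambda>i. if i \<in> S then 1 else 0) (E_poly a k l js) =
        (\<Sum>T\<in>?A. if T = S then e S else 0)"
        unfolding e mp_eval_sum[OF comm_ring_hom_ident]
      proof (rule sum.cong[OF refl])
        fix T assume T: "T \<in> ?A"
        have "\<not> T \<subseteq> S" if "T \<noteq> S"
          using T that S(2,3) card_subset_eq[of S T] by auto
        then show "mp_eval (\<lambda>c. c) (\<lambda>i. if i \<in> S then 1 else 0)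
            (Poly_Mapping.single (squarefree_monom T) (e T)) = (if T = S then e S else 0)"
          using finT[OF T]
          by (auto simp: mp_eval_single[OF comm_ring_hom_ident] monom_val_squarefree_monom)
      qed
      also have "\<dots> = e S"
        using S_A by (subst sum.delta[OF finA]) simp
      finally have eS: "e S \<noteq> 0"
        using E_poly_indicator_nonzero[OF inj_on_subset[OF inj sub] js(1) len, of S] S set_js by auto
      \<comment> \<open>All variables of \<open>S\<close> occur in \<open>m\<close>, so the
        truncated subtraction is exact.\<close>
      define m' where "m' = m - squarefree_monom S"
      have m: "m = m' + squarefree_monom S"
        using S
        by (intro poly_mapping_eqI)
           (auto simp: m'_def lookup_add lookup_minus lookup_squarefree_monom in_keys_iff Suc_le_eq
             dest!: subsetD)
      have keys_m': "Poly_Mapping.keys m' \<subseteq> {1..n}"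
        using less.prems by (auto simp: m'_def in_keys_iff lookup_minus subset_iff)
      \<comment> \<open>The remaining terms of the multiple of \<open>E\<close> that is scaled to
        have coefficient \<open>c\<close> at \<open>m\<close>.\<close>
      define r where "r = (\<Sum>T\<in>?A - {S}. Poly_Mapping.single (m' + squarefree_monom T) (c / e S * e T))"
      have "reducible r"
        unfolding r_def
      proof (rule red_sum, rule less.hyps)
        fix T assume T: "T \<in> ?A - {S}"
        \<comment> \<open>\<open>T\<close> lies in \<open>C \<union> S\<close> and has the size of
          \<open>S\<close> but differs from it, so it misses an element of \<open>S\<close>.\<close>
        then have "T - C \<subset> S"
          using set_js S card_subset_eq[of T S] finT[of T] by auto
        then have "card (T - C) < card S"
          using S(3) by (rule psubset_card_mono[rotated])
        moreover have "S - C = S" using S(1) by auto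
        moreover have "T \<subseteq> {1..n}" "S \<subseteq> {1..n}"
          using T sub set_js by blast+
        ultimately show "outdeg (m' + squarefree_monom T) < outdeg m"
          by (simp only: m outdeg_add outdeg_sqf)
        show "Poly_Mapping.keys (m' + squarefree_monom T) \<subseteq> {1..n}"
          using Poly_Mapping.keys_add[of m' "squarefree_monom T"] keys_m' T sub finT[of T]
          by (auto simp: keys_squarefree_monom)
      qed
      then obtain q where q: "q \<in> carrier (mp_ring n)" "r - q \<in> J"
        "\<forall>m\<in>Poly_Mapping.keys q. card (Poly_Mapping.keys m - C) \<le> l"
        unfolding reducible_def by blast
      have "Poly_Mapping.single m' (c / e S) * E_poly a k l js =
          (\<Sum>T\<in>?A. Poly_Mapping.single (m' + squarefree_monom T) (c / e S * e T))"
        by (simp add: e sum_distrib_left mult_single)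
      also have "\<dots> = Poly_Mapping.single m c + r"
        unfolding r_def using eS by (subst sum.remove[OF finA S_A]) (simp add: m)
      finally have "Poly_Mapping.single m c + r = Poly_Mapping.single m' (c / e S) * E_poly a k l js" ..
      also have "\<dots> \<in> J"
        using keys_m' EJ[OF len sub js(2)] set_js
        by (intro J_closed(5)) (auto simp: mem_carrier_mp_ring_iff mp_vars_def split: if_splits)
      \<comment> \<open>The difference is the original monomial plus \<open>q\<close>, so
        \<open>- q\<close> is its remainder.\<close>
      finally have "(Poly_Mapping.single m c + r) - (r - q) \<in> J"
        using q(2) by (rule J_closed(4))
      then have "Poly_Mapping.single m c - (- q) \<in> J"
        by simp
      then show ?thesis
        unfolding reducible_def using q by (intro bexI[of _ "- q"]) (auto simp: mp_ring_closed)
    qed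
  qed
  have "reducible (\<Sum>m\<in>Poly_Mapping.keys p. Poly_Mapping.single m (Poly_Mapping.lookup p m))"
    using p by (intro red_sum red_single) (auto simp: mem_carrier_mp_ring_iff mp_vars_def)
  then show ?thesis
    by (simp add: poly_mapping_sum_singles reducible_def)
qed

section \<open>Generation and minimality\<close>

definition core_generators :: "(nat \<Rightarrow> 'a::field) \<Rightarrow> nat \<Rightarrow> nat \<Rightarrow> nat \<Rightarrow> nat set \<Rightarrow> 'a mpol set" where
  "core_generators a k l n C = {E_poly a k l js | js.
     length js = k + l + 2 \<and> set js \<subseteq> {1..n} \<and> sorted_wrt (<) js \<and> C \<subseteq> set js}"

lemma core_generators_subset_carrier: "core_generators a k l n C \<subseteq> carrier (mp_ring n)"
  unfolding core_generators_def using E_poly_in_carrier by blast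

lemma finite_core_generators: "finite (core_generators a k l n C)"
proof -
  have "finite {js. set js \<subseteq> {1..n} \<and> length js = k + l + 2}"
    by (rule finite_lists_length_eq) simp
  then have "finite (E_poly a k l ` {js. set js \<subseteq> {1..n} \<and> length js = k + l + 2})"
    by (rule finite_imageI)
  then show ?thesis
    by (rule rev_finite_subset) (auto simp: core_generators_def)
qed

lemma genideal_E_polys_subset:
  assumes "B \<subseteq> {E_poly a k l js | js. length js = k + l + 2 \<and> set js \<subseteq> {1..n}}"
  shows "genideal (mp_ring n) B \<subseteq> rfe_vanishing_ideal k l n a"
proof -
  interpret cring "mp_ring n :: 'a mpol ring" by (rule cring_mp_ring)
  show ?thesis
    using assms E_poly_in_rfe_vanishing_ideal
    by (intro genideal_minimal ideal_rfe_vanishing_ideal) blast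
qed

text \<open>Covers the case in which no \<open>C\<close> of size \<open>k + 1\<close> exists: with
  \<open>C = {1..n}\<close> no variable lies outside \<open>C\<close>, so every nonzero polynomial
  has a good seed.\<close>

lemma seed_vanishing_imp_zero:
  fixes \<phi> :: "'a::field \<Rightarrow> 'b::field" and a :: "nat \<Rightarrow> 'a"
  assumes hom: "comm_ring_hom \<phi>" and inf: "infinite (UNIV :: 'b set)"
    and inj: "inj_on a {1..n}" and n: "n \<le> k"
    and p: "p \<in> carrier (mp_ring n)"
    and van: "\<And>g h. Polynomial.degree g \<le> k \<Longrightarrow> Polynomial.degree h \<le> l \<Longrightarrow> h \<noteq> 0 \<Longrightarrow>
      (\<And>i. i \<in> {1..n} \<Longrightarrow> poly h (\<phi> (a i)) \<noteq> 0) \<Longrightarrow>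
      mp_eval \<phi> (\<lambda>i. poly g (\<phi> (a i)) / poly h (\<phi> (a i))) p = 0"
  shows "p = 0"
proof (rule ccontr)
  assume nz: "p \<noteq> 0"
  have "card (Poly_Mapping.keys m - {1..n}) \<le> l" if "m \<in> Poly_Mapping.keys p" for m
  proof -
    have "Poly_Mapping.keys m - {1..n} = {}"
      using p that by (auto simp: mem_carrier_mp_ring_iff mp_vars_def)
    then show ?thesis by (simp only: card.empty le0)
  qed
  from exists_nonvanishing_seed[OF hom inf inj _ _ p nz this, of k] show False
    using n van by auto
qed

text \<open>Both \<open>p\<close> and the ideal element \<open>p - q\<close> vanish at all seeds,
  hence so does the remainder \<open>q\<close>, which must then be 0.\<close>

lemma seed_vanishing_imp_genideal:
  fixes \<phi> :: "'a::field \<Rightarrow> 'b::field" and a :: "nat \<Rightarrow> 'a"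
  assumes hom: "comm_ring_hom \<phi>" and inf: "infinite (UNIV :: 'b set)"
    and inj: "inj_on a {1..n}" and C: "C \<subseteq> {1..n}" "card C = k + 1"
    and p: "p \<in> carrier (mp_ring n)"
    and van: "\<And>g h. Polynomial.degree g \<le> k \<Longrightarrow> Polynomial.degree h \<le> l \<Longrightarrow> h \<noteq> 0 \<Longrightarrow>
      (\<And>i. i \<in> {1..n} \<Longrightarrow> poly h (\<phi> (a i)) \<noteq> 0) \<Longrightarrow>
      mp_eval \<phi> (\<lambda>i. poly g (\<phi> (a i)) / poly h (\<phi> (a i))) p = 0"
  shows "p \<in> genideal (mp_ring n) (core_generators a k l n C)"
proof -
  interpret cring "mp_ring n :: 'a mpol ring" by (rule cring_mp_ring)
  let ?J = "genideal (mp_ring n) (core_generators a k l n C)"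
  have J: "ideal ?J (mp_ring n)"
    by (rule genideal_ideal[OF core_generators_subset_carrier])
  have gen: "core_generators a k l n C \<subseteq> ?J"
    by (rule genideal_self[OF core_generators_subset_carrier])
  have "\<exists>q\<in>carrier (mp_ring n). p - q \<in> ?J \<and>
    (\<forall>m\<in>Poly_Mapping.keys q. card (Poly_Mapping.keys m - C) \<le> l)"
    by (rule reduce_modulo_E_polys[OF inj C J _ p]) (use gen in \<open>auto simp: core_generators_def\<close>)
  then obtain q where q: "q \<in> carrier (mp_ring n)" "p - q \<in> ?J"
    "\<And>m. m \<in> Poly_Mapping.keys q \<Longrightarrow> card (Poly_Mapping.keys m - C) \<le> l"
    by blast
  have sub: "?J \<subseteq> rfe_vanishing_ideal k l n a"
    by (rule genideal_E_polys_subset) (auto simp: core_generators_def)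
  have "q = 0"
  proof (rule ccontr)
    assume "q \<noteq> 0"
    obtain g h where gh: "Polynomial.degree g \<le> k" "Polynomial.degree h \<le> l" "h \<noteq> 0"
      "\<And>i. i \<in> {1..n} \<Longrightarrow> poly h (\<phi> (a i)) \<noteq> 0"
      and nz: "mp_eval \<phi> (\<lambda>i. poly g (\<phi> (a i)) / poly h (\<phi> (a i))) q \<noteq> 0"
      using exists_nonvanishing_seed[OF hom inf inj C(1) _ q(1) \<open>q \<noteq> 0\<close> q(3), of k] C(2)
      by auto
    let ?x = "\<lambda>i. poly g (\<phi> (a i)) / poly h (\<phi> (a i))"
    have "mp_eval \<phi> ?x (p - q) = 0"
      using q(2) sub gh by (intro rfe_vanishing_ideal_imp_seed[OF hom]) auto
    moreover have "mp_eval \<phi> ?x p = 0"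
      using gh by (rule van)
    moreover have "mp_eval \<phi> ?x p = mp_eval \<phi> ?x (p - q) + mp_eval \<phi> ?x q"
      unfolding mp_eval_add[OF hom, symmetric] by simp
    ultimately show False
      using nz by simp
  qed
  with q(2) show ?thesis by simp
qed

text \<open>The powers of the indeterminate are distinct. This field extends an arbitrary, possibly
  finite, field to an infinite one.\<close>

lemma infinite_poly_fract: "infinite (UNIV :: 'a::field poly fract set)"
proof -
  have "inj (\<lambda>e::nat. Fract (Polynomial.monom 1 e) (1 :: 'a poly))"
    by (rule injI) (metis degree_monom_eq eq_fract(1) mult_1_right one_neq_zero)
  then show ?thesis
    using range_inj_infinite finite_subset subset_UNIV by metis
qed

text \<open>Restriction to the line through the origin and the indicator vector of \<open>S\<close>:
  the coefficient at \<open>j\<close> is the value at that vector of the homogeneous component of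
  degree \<open>j\<close>.\<close>

definition line_eval :: "nat set \<Rightarrow> 'a::field mpol \<Rightarrow> 'a poly" where
  "line_eval S = mp_eval (\<lambda>c. [:c:]) (\<lambda>i. if i \<in> S then [:0, 1:] else 0)"

lemma comm_ring_hom_line_eval: "comm_ring_hom (line_eval S)"
  unfolding line_eval_def by (rule comm_ring_hom_mp_eval[OF comm_ring_hom_pCons])

text \<open>The constant term is the same for all \<open>S\<close>, which later makes multiplication
  act as a scalar in lowest degree.\<close>

lemma coeff_line_eval_0: "coeff (line_eval S p) 0 = mp_eval (\<lambda>c. c) (\<lambda>i. 0) p"
proof -
  have "coeff (line_eval S p) 0 = poly (line_eval S p) 0"
    by (simp add: poly_0_coeff_0)
  also have "\<dots> = (\<Sum>m\<in>Poly_Mapping.keys p. Poly_Mapping.lookup p m *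
      (\<Prod>i\<in>Poly_Mapping.keys m. poly (if i \<in> S then [:0, 1:] else 0) 0 ^ Poly_Mapping.lookup m i))"
    by (simp add: line_eval_def mp_eval_def poly_sum poly_prod)
  also have "\<dots> = mp_eval (\<lambda>c. c) (\<lambda>i. 0) p"
    unfolding mp_eval_def by (intro sum.cong prod.cong arg_cong2[of _ _ _ _ "(*)"] refl) auto
  finally show ?thesis .
qed

text \<open>\<open>E\<close> is homogeneous of degree \<open>l + 1\<close>, so on a line only one
  power of the parameter remains.\<close>

lemma line_eval_E_poly:
  fixes a :: "nat \<Rightarrow> 'a::field"
  assumes "distinct js" "length js = k + l + 2"
  shows "line_eval S (E_poly a k l js) =
    Polynomial.monom (mp_eval (\<lambda>c. c) (\<lambda>i. if i \<in> S then 1 else 0) (E_poly a k l js)) (l + 1)"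
proof -
  let ?A = "{T. T \<subseteq> set js \<and> card T = l + 1}"
  obtain e where e: "E_poly a k l js = (\<Sum>T\<in>?A. Poly_Mapping.single (squarefree_monom T) (e T))"
    using E_poly_expansion[OF assms] by blast
  have finT: "finite T" if "T \<in> ?A" for T
    using that finite_subset[of T "set js"] by auto
  have prod_if: "(\<Prod>i\<in>T. if i \<in> S then y else 0) = (if T \<subseteq> S then y ^ card T else 0)"
    if "finite T" for T and y :: "'c::idom"
    using that by (auto intro!: prod_zero simp: subset_iff)
  have "line_eval S (E_poly a k l js) = (\<Sum>T\<in>?A. if T \<subseteq> S then Polynomial.monom (e T) (l + 1) else 0)"
    unfolding e line_eval_def mp_eval_sum[OF comm_ring_hom_pCons]
  proof (rule sum.cong[OF refl])
    fix T assume T: "T \<in> ?A"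
    have "[:e T:] * [:0, 1:] ^ card T = Polynomial.monom (e T) (l + 1)"
      using T by (simp add: monom_altdef)
    then show "mp_eval (\<lambda>c. [:c:]) (\<lambda>i. if i \<in> S then [:0, 1:] else 0)
        (Poly_Mapping.single (squarefree_monom T) (e T)) =
        (if T \<subseteq> S then Polynomial.monom (e T) (l + 1) else 0)"
      unfolding mp_eval_single[OF comm_ring_hom_pCons] monom_val_squarefree_monom[OF finT[OF T]]
        prod_if[OF finT[OF T]] by auto
  qed
  also have "\<dots> = Polynomial.monom (\<Sum>T\<in>?A. if T \<subseteq> S then e T else 0) (l + 1)"
    unfolding poly_eq_iff coeff_sum coeff_monom
    by (auto intro!: sum.cong sum.neutral simp: coeff_sum)
  also have "(\<Sum>T\<in>?A. if T \<subseteq> S then e T else 0) =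
      mp_eval (\<lambda>c. c) (\<lambda>i. if i \<in> S then 1 else 0) (E_poly a k l js)"
    unfolding e mp_eval_sum[OF comm_ring_hom_ident]
  proof (rule sum.cong[OF refl])
    fix T assume T: "T \<in> ?A"
    show "(if T \<subseteq> S then e T else 0) = mp_eval (\<lambda>c. c) (\<lambda>i. if i \<in> S then 1 else 0)
        (Poly_Mapping.single (squarefree_monom T) (e T))"
      unfolding mp_eval_single[OF comm_ring_hom_ident] monom_val_squarefree_monom[OF finT[OF T]]
        prod_if[OF finT[OF T]] by auto
  qed
  finally show ?thesis .
qed

text \<open>The ideal is generated in degree \<open>l + 1\<close>, so modulo higher degree a generating set has to
  span the vector space spanned by the \<open>E\<close>'s. The restriction to the lines through the indicator
  vectors records the relevant part of the component of degree \<open>l + 1\<close>.\<close>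

lemma card_core_generators_le:
  fixes a :: "nat \<Rightarrow> 'a::field"
  assumes inj: "inj_on a {1..n}" and C: "C \<subseteq> {1..n}" "card C = k + 1"
    and G: "finite G" "G \<subseteq> carrier (mp_ring n)"
    and gen: "genideal (mp_ring n) G = genideal (mp_ring n) (core_generators a k l n C)"
  shows "card (core_generators a k l n C) \<le> card G"
proof -
  interpret cring "mp_ring n :: 'a mpol ring" by (rule cring_mp_ring)
  interpret fv: vector_space "\<lambda>(c::'a) (f::nat set \<Rightarrow> 'a) S. c * f S"
    by unfold_locales (auto simp: fun_eq_iff algebra_simps)
  let ?B = "core_generators a k l n C"
  \<comment> \<open>\<open>\<Phi>\<close> records the degree \<open>l + 1\<close> part on all lines;
    \<open>low\<close> says that no smaller degree occurs on any of them.\<close>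
  define \<Phi> where "\<Phi> p = (\<lambda>S. coeff (line_eval S p) (l + 1))" for p :: "'a mpol"
  define low where "low p \<longleftrightarrow> (\<forall>S. \<forall>j\<le>l. coeff (line_eval S p) j = 0)" for p :: "'a mpol"
  have hom: "comm_ring_hom (line_eval S :: 'a mpol \<Rightarrow> 'a poly)" for S
    by (rule comm_ring_hom_line_eval)
  have ev_add: "line_eval S (p + q) = line_eval S p + line_eval S q"
    and ev_mult: "line_eval S (p * q) = line_eval S p * line_eval S q"
    and ev_0: "line_eval S (0 :: 'a mpol) = 0" for S and p q :: "'a mpol"
  proof -
    interpret comm_ring_hom "line_eval S :: 'a mpol \<Rightarrow> 'a poly" by (rule hom)
    show "line_eval S (p + q) = line_eval S p + line_eval S q"
      "line_eval S (p * q) = line_eval S p * line_eval S q" "line_eval S (0 :: 'a mpol) = 0"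
      by (simp_all add: hom_add hom_mult)
  qed
  have low_mult: "low (r * p)" if "low p" for r p
    using that unfolding low_def ev_mult coeff_mult by (auto intro!: sum.neutral)
  \<comment> \<open>Since \<open>p\<close> starts in degree \<open>l + 1\<close>, only the constant
    term of \<open>r\<close> contributes there.\<close>
  have \<Phi>_mult: "\<Phi> (r * p) = (\<lambda>S. mp_eval (\<lambda>c. c) (\<lambda>i. 0) r * \<Phi> p S)" if "low p" for r p
  proof
    fix S
    have "coeff (line_eval S r * line_eval S p) (l + 1) =
        (\<Sum>i\<le>l + 1. if i = 0 then coeff (line_eval S r) 0 * coeff (line_eval S p) (l + 1) else 0)"
      unfolding coeff_mult using that by (intro sum.cong) (auto simp: low_def)
    then show "\<Phi> (r * p) S = mp_eval (\<lambda>c. c) (\<lambda>i. 0) r * \<Phi> p S"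
      by (simp add: \<Phi>_def ev_mult coeff_line_eval_0)
  qed
  have \<Phi>_add: "\<Phi> (p + q) = \<Phi> p + \<Phi> q" for p q
    by (simp add: \<Phi>_def ev_add fun_eq_iff)
  have \<Phi>_0: "\<Phi> 0 = 0"
    by (simp add: \<Phi>_def ev_0 fun_eq_iff)
  have low_B: "low p" if "p \<in> ?B" for p
    using that by (auto simp: core_generators_def low_def line_eval_E_poly strict_sorted_iff)
  \<comment> \<open>The \<open>low\<close> polynomials form an ideal containing the
    \<open>E\<close>'s, hence the ideal they generate and with it \<open>G\<close>.\<close>
  have "ideal {p \<in> carrier (mp_ring n). low p} (mp_ring n)"
    by (rule ideal_mp_ringI) (auto simp: mp_ring_closed low_mult, auto simp: low_def ev_0 ev_add)
  then have "genideal (mp_ring n) ?B \<subseteq> {p \<in> carrier (mp_ring n). low p}"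
    using core_generators_subset_carrier[of a k l n C] low_B by (intro genideal_minimal) auto
  moreover have "G \<subseteq> genideal (mp_ring n) G"
    by (rule genideal_self[OF G(2)])
  ultimately have low_G: "low p" if "p \<in> G" for p
    using gen that by auto
  \<comment> \<open>An ideal containing \<open>G\<close>, hence containing the core generators; so
    the images of the latter lie in a space spanned by at most \<open>card G\<close>
    vectors.\<close>
  define K where "K = {p \<in> carrier (mp_ring n). low p \<and> \<Phi> p \<in> fv.span (\<Phi> ` G)}"
  have "ideal K (mp_ring n)"
  proof (rule ideal_mp_ringI)
    show "0 \<in> K"
      by (auto simp: K_def mp_ring_closed \<Phi>_0 fv.span_zero low_def ev_0)
    show "p + q \<in> K" if "p \<in> K" "q \<in> K" for p q
      using that by (auto simp: K_def mp_ring_closed \<Phi>_add fv.span_add low_def ev_add)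
    show "r * p \<in> K" if "r \<in> carrier (mp_ring n)" "p \<in> K" for r p
    proof -
      have "low p" "\<Phi> p \<in> fv.span (\<Phi> ` G)" "p \<in> carrier (mp_ring n)"
        using that by (auto simp: K_def)
      then show ?thesis
        using that(1) fv.span_scale[of "\<Phi> p" "\<Phi> ` G"]
        by (simp add: K_def mp_ring_closed low_mult \<Phi>_mult)
    qed
  qed (auto simp: K_def)
  moreover have "G \<subseteq> K"
    using G low_G fv.span_base by (auto simp: K_def)
  ultimately have "genideal (mp_ring n) G \<subseteq> K"
    by (rule genideal_minimal)
  then have "?B \<subseteq> K"
    using gen genideal_self[OF core_generators_subset_carrier] by blast
  then have span: "\<Phi> ` ?B \<subseteq> fv.span (\<Phi> ` G)"
    by (auto simp: K_def)
  have \<Phi>_E: "\<Phi> (E_poly a k l js) S = mp_eval (\<lambda>c. c) (\<lambda>i. if i \<in> S then 1 else 0) (E_poly a k l js)"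
    if "distinct js" "length js = k + l + 2" for js S
    by (simp add: \<Phi>_def line_eval_E_poly[OF that])
  \<comment> \<open>The indicator of the index set without \<open>C\<close> separates a core
    generator from all others, which gives injectivity of \<open>\<Phi>\<close> and linear
    independence at once.\<close>
  have sep: "\<exists>S. \<Phi> p S \<noteq> 0 \<and> (\<forall>q\<in>?B. q \<noteq> p \<longrightarrow> \<Phi> q S = 0)" if "p \<in> ?B" for p
  proof -
    obtain js where js: "p = E_poly a k l js" "length js = k + l + 2" "set js \<subseteq> {1..n}"
      "sorted_wrt (<) js" "C \<subseteq> set js"
      using \<open>p \<in> ?B\<close> unfolding core_generators_def by blast
    have dist: "distinct js" using js(4) by (simp add: strict_sorted_iff)
    have "finite C" using js(5) by (rule finite_subset) simp
    let ?S = "set js - C"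
    have card_S: "card ?S = l + 1"
      using js C \<open>finite C\<close> dist by (simp add: card_Diff_subset distinct_card)
    have "\<Phi> q ?S = 0" if q: "q \<in> ?B" "q \<noteq> p" for q
    proof -
      obtain js' where js': "q = E_poly a k l js'" "length js' = k + l + 2" "set js' \<subseteq> {1..n}"
        "sorted_wrt (<) js'" "C \<subseteq> set js'"
        using q(1) unfolding core_generators_def by blast
      have dist': "distinct js'" using js'(4) by (simp add: strict_sorted_iff)
      \<comment> \<open>Otherwise both index sets contain \<open>C\<close> and \<open>?S\<close> and
        have equal size, so the two sorted lists coincide.\<close>
      have "\<not> ?S \<subseteq> set js'"
      proof
        assume "?S \<subseteq> set js'"
        with js'(5) have "set js \<subseteq> set js'" by blast
        moreover have "card (set js) = card (set js')"
          using dist dist' js(2) js'(2) by (simp add: distinct_card)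
        ultimately have "set js = set js'"
          by (intro card_subset_eq) auto
        with js(4) js'(4) have "js = js'"
          by (metis strict_sorted_equal)
        with q(2) js(1) js'(1) show False by simp
      qed
      then have "set js' \<inter> ?S \<subset> ?S" by blast
      then have "card (set js' \<inter> ?S) < card ?S"
        by (intro psubset_card_mono) auto
      then have "card (set js' \<inter> ?S) \<le> l"
        using card_S by simp
      from E_poly_indicator_zero[OF js'(2) this] show ?thesis
        by (simp only: js'(1) \<Phi>_E[OF dist' js'(2)])
    qed
    moreover have "\<Phi> p ?S \<noteq> 0"
      unfolding js(1) \<Phi>_E[OF dist js(2)]
      by (rule E_poly_indicator_nonzero[OF inj_on_subset[OF inj js(3)] dist js(2) _ card_S]) auto
    ultimately show ?thesis by blast
  qed
  have "inj_on \<Phi> ?B"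
  proof (rule inj_onI, rule ccontr)
    fix p q assume pq: "p \<in> ?B" "q \<in> ?B" "\<Phi> p = \<Phi> q" "p \<noteq> q"
    obtain S where "\<Phi> p S \<noteq> 0" "\<forall>q\<in>?B. q \<noteq> p \<longrightarrow> \<Phi> q S = 0"
      using sep[OF pq(1)] by blast
    with pq show False by metis
  qed
  moreover have "fv.independent (\<Phi> ` ?B)"
    unfolding fv.dependent_def
  proof safe
    fix p assume p: "p \<in> ?B" "\<Phi> p \<in> fv.span (\<Phi> ` ?B - {\<Phi> p})"
    obtain S where S: "\<Phi> p S \<noteq> 0" "\<forall>q\<in>?B. q \<noteq> p \<longrightarrow> \<Phi> q S = 0"
      using sep[OF p(1)] by blast
    \<comment> \<open>The functions vanishing at \<open>S\<close> form a subspace that contains all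
      the other images.\<close>
    have "fv.span (\<Phi> ` ?B - {\<Phi> p}) \<subseteq> {f. f S = 0}"
      by (rule fv.span_minimal) (use S in \<open>auto simp: fv.subspace_def\<close>)
    with p(2) S(1) show False by blast
  qed
  then have "card (\<Phi> ` ?B) \<le> card (\<Phi> ` G)"
    using fv.independent_span_bound[OF _ _ span] G(1) by blast
  moreover have "card (\<Phi> ` G) \<le> card G"
    by (rule card_image_le[OF G(1)])
  ultimately show ?thesis
    by (simp add: card_image)
qed

theorem mainTheorem1:
  fixes a :: "nat \<Rightarrow> 'a::field" and k l n :: nat
  assumes "inj_on a {1..n}"
  shows "(infinite (UNIV :: 'a set) \<longrightarrow>
            rfe_seed_vanishing_ideal k l n a = rfe_vanishing_ideal k l n a) \<and>
         rfe_vanishing_ideal k l n a =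
           genideal (mp_ring n)
             {E_poly a k l js | js. length js = k + l + 2 \<and> set js \<subseteq> {1..n}} \<and>
         (\<forall>C. C \<subseteq> {1..n} \<and> card C = k + 1 \<longrightarrow>
           min_size_generating_set (mp_ring n) (rfe_vanishing_ideal k l n a)
             {E_poly a k l js | js.
                length js = k + l + 2 \<and> set js \<subseteq> {1..n} \<and> sorted_wrt (<) js \<and> C \<subseteq> set js})"
proof -
  interpret cring "mp_ring n :: 'a mpol ring" by (rule cring_mp_ring)
  let ?I = "rfe_vanishing_ideal k l n a"
  let ?E = "{E_poly a k l js | js. length js = k + l + 2 \<and> set js \<subseteq> {1..n}}"
  have E_carrier: "?E \<subseteq> carrier (mp_ring n)"
    using E_poly_in_carrier by blast
  have I_carrier: "?I \<subseteq> carrier (mp_ring n)"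
    by (auto simp: rfe_vanishing_ideal_def)
  have core_I: "?I = genideal (mp_ring n) (core_generators a k l n C)"
    if C: "C \<subseteq> {1..n}" "card C = k + 1" for C
  proof
    show "?I \<subseteq> genideal (mp_ring n) (core_generators a k l n C)"
    proof
      fix p assume p: "p \<in> ?I"
      show "p \<in> genideal (mp_ring n) (core_generators a k l n C)"
        \<comment> \<open>Seeds over \<open>F(t)\<close> make the argument uniform in the field,
          finite or not.\<close>
        by (rule seed_vanishing_imp_genideal[OF comm_ring_hom_Fract_pCons infinite_poly_fract assms C])
           (use p I_carrier in \<open>auto intro!: rfe_vanishing_ideal_imp_seed[OF comm_ring_hom_Fract_pCons]\<close>)
    qed
    show "genideal (mp_ring n) (core_generators a k l n C) \<subseteq> ?I"
      by (rule genideal_E_polys_subset) (auto simp: core_generators_def)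
  qed
  have core_sub: "genideal (mp_ring n) (core_generators a k l n C) \<subseteq> genideal (mp_ring n) ?E" for C
    by (rule genideal_minimal[OF genideal_ideal[OF E_carrier]])
       (use genideal_self[OF E_carrier] in \<open>auto simp: core_generators_def\<close>)
  have zero_E: "0 \<in> genideal (mp_ring n) ?E"
    using ideal_mp_ringD(2)[OF genideal_ideal[OF E_carrier]] .
  have seed_sub: "?I \<subseteq> rfe_seed_vanishing_ideal k l n a"
    using rfe_vanishing_ideal_imp_seed[OF comm_ring_hom_ident, of _ k l n a] I_carrier
    unfolding rfe_seed_vanishing_ideal_def by blast
  have E_sub: "genideal (mp_ring n) ?E \<subseteq> ?I"
    by (rule genideal_E_polys_subset) auto
  have "?I \<subseteq> genideal (mp_ring n) ?E \<and>
    (infinite (UNIV :: 'a set) \<longrightarrow> rfe_seed_vanishing_ideal k l n a \<subseteq> ?I)"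
  \<comment> \<open>If \<open>n \<le> k\<close>, there is no \<open>C\<close> of size
    \<open>k + 1\<close>, and both vanishing ideals turn out to be zero where claimed. Otherwise one
    particular \<open>C\<close> suffices for generation by all \<open>E\<close>'s.\<close>
  proof (cases "n \<le> k")
    case True
    have "p = 0" if "p \<in> ?I" for p
      by (rule seed_vanishing_imp_zero[OF comm_ring_hom_Fract_pCons infinite_poly_fract assms True])
         (use that I_carrier in \<open>auto intro!: rfe_vanishing_ideal_imp_seed[OF comm_ring_hom_Fract_pCons]\<close>)
    moreover have "p = 0" if "infinite (UNIV :: 'a set)" "p \<in> rfe_seed_vanishing_ideal k l n a" for p
      by (rule seed_vanishing_imp_zero[OF comm_ring_hom_ident that(1) assms True])
         (use that(2) in \<open>auto simp: rfe_seed_vanishing_ideal_def\<close>)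
    ultimately show ?thesis
      using zero_E E_sub by blast
  next
    case False
    then have C: "{1..k + 1} \<subseteq> {1..n}" "card {1..k + 1} = k + 1" by auto
    have "p \<in> ?I" if "infinite (UNIV :: 'a set)" "p \<in> rfe_seed_vanishing_ideal k l n a" for p
      unfolding core_I[OF C]
      \<comment> \<open>Over an infinite field the seeds over the field itself already suffice, so
        the identity embedding is used.\<close>
      by (rule seed_vanishing_imp_genideal[OF comm_ring_hom_ident that(1) assms C])
         (use that(2) in \<open>auto simp: rfe_seed_vanishing_ideal_def\<close>)
    then show ?thesis
      using core_I[OF C] core_sub by blast
  qed
  moreover have "min_size_generating_set (mp_ring n) ?I (core_generators a k l n C)"
    if C: "C \<subseteq> {1..n}" "card C = k + 1" for C
    unfolding min_size_generating_set_def core_I[OF C]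
    using finite_core_generators core_generators_subset_carrier
      card_core_generators_le[OF assms C] by blast
  ultimately show ?thesis
    using seed_sub E_sub unfolding core_generators_def by blast
qed

end
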